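(* There exist absolute constants $c, C > 0$ such that the following holds. Consider the algorithm which, given $\varepsilon > 0$ and access to independent samples from an unknown distribution $\mathcal{D}$ on $\mathbb{R}^n$, draws $T = C n/\varepsilon^2$ samples $x^{(1)},\dots,x^{(T)} \sim \mathcal{D}$, computes $M = \frac{1}{T}\sum_{i=1}^T \|x^{(i)}\|^2$, and outputs "un-truncated" if $M \ge n - c\varepsilon/2$ and "truncated" otherwise. Suppose $\mathcal{D} \in \mathcal{P}_{\mathrm{symm}}$. Then: (1) if $\mathcal{D} = N(0,I_n)$, the algorithm outputs "un-truncated" with probability at least $9/10$; (2) if $d_{\mathrm{TV}}(\mathcal{D}, N(0,I_n)) \ge \varepsilon$, the algorithm outputs "truncated" with probability at least $9/10$.
   Context: $\|\cdot\|$ is the Euclidean norm. For a Lebesgue measurable $K \subseteq \mathbb{R}^n$ with Gaussian volume $\mathrm{vol}(K) := \Pr_{x\sim N(0,I_n)}[x\in K] > 0$, $N(0,I_n)|_K$ denotes the standard Gaussian conditioned on $K$, i.e. the distribution with density $\mathrm{vol}(K)^{-1}\varphi_n(x)\mathbf{1}[x\in K]$, where $\varphi_n$ is the standard Gaussian density. A set $K$ is symmetric if $-x\in K$ whenever $x \in K$. $\mathcal{P}_{\mathrm{symm}}$ is the class of all distributions $N(0,I_n)|_K$ where $K\subseteq\mathbb{R}^n$ is a symmetric convex set. $d_{\mathrm{TV}}$ denotes total variation distance. *)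

theory Defs
  imports "HOL-Probability.Probability"
begin

text \<open>
  The dimension must be an ordinary natural number here, since the constants of the theorem are
  chosen before it. Points of \<open>\<real>\<^sup>n\<close> are therefore the elements of \<open>{..<n} \<rightarrow>\<^sub>E UNIV\<close>, the underlying
  space of the product measure below, and the Euclidean norm of \<open>x\<close> is \<^term>\<open>L2_set x {..<n}\<close>.
\<close>

definition lebesgue_Rn :: "nat \<Rightarrow> (nat \<Rightarrow> real) measure" where
  "lebesgue_Rn n = completion (PiM {..<n} (\<lambda>_. lborel))"

definition gaussian_density :: "nat \<Rightarrow> (nat \<Rightarrow> real) \<Rightarrow> real" where
  "gaussian_density n x = (\<Prod>i<n. std_normal_density (x i))"

definition std_gaussian :: "nat \<Rightarrow> (nat \<Rightarrow> real) measure" where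
  "std_gaussian n = density (lebesgue_Rn n) (\<lambda>x. ennreal (gaussian_density n x))"

definition gaussian_vol :: "nat \<Rightarrow> (nat \<Rightarrow> real) set \<Rightarrow> real" where
  "gaussian_vol n K = measure (std_gaussian n) K"

definition truncated_gaussian :: "nat \<Rightarrow> (nat \<Rightarrow> real) set \<Rightarrow> (nat \<Rightarrow> real) measure" where
  "truncated_gaussian n K =
     density (lebesgue_Rn n)
       (\<lambda>x. ennreal (inverse (gaussian_vol n K) * gaussian_density n x * indicator K x))"

text \<open>
  The type \<open>nat \<Rightarrow> real\<close> is not an instance of \<^class>\<open>real_vector\<close>; the restriction to \<open>{..<n}\<close> keeps
  the pointwise operations inside \<open>{..<n} \<rightarrow>\<^sub>E UNIV\<close>.
\<close>

definition convex_Rn :: "nat \<Rightarrow> (nat \<Rightarrow> real) set \<Rightarrow> bool" where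
  "convex_Rn n K \<longleftrightarrow>
     (\<forall>x\<in>K. \<forall>y\<in>K. \<forall>u\<ge>0. \<forall>v\<ge>0. u + v = 1 \<longrightarrow> (\<lambda>i\<in>{..<n}. u * x i + v * y i) \<in> K)"

definition symmetric_Rn :: "nat \<Rightarrow> (nat \<Rightarrow> real) set \<Rightarrow> bool" where
  "symmetric_Rn n K \<longleftrightarrow> (\<forall>x\<in>K. (\<lambda>i\<in>{..<n}. - x i) \<in> K)"

definition P_symm :: "nat \<Rightarrow> (nat \<Rightarrow> real) measure set" where
  "P_symm n = {truncated_gaussian n K | K.
     K \<in> sets (lebesgue_Rn n) \<and> gaussian_vol n K > 0 \<and> symmetric_Rn n K \<and> convex_Rn n K}"

text \<open>Meant for probability measures \<open>P\<close> and \<open>Q\<close> with the same \<open>\<sigma>\<close>-algebra.\<close>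

definition tv_dist :: "'a measure \<Rightarrow> 'a measure \<Rightarrow> real" where
  "tv_dist P Q = (SUP A\<in>sets P. \<bar>measure P A - measure Q A\<bar>)"

datatype verdict = Untruncated | Truncated

definition num_samples :: "real \<Rightarrow> nat \<Rightarrow> real \<Rightarrow> nat" where
  "num_samples C n \<epsilon> = nat \<lceil>C * real n / \<epsilon>\<^sup>2\<rceil>"

definition mean_sq_norm :: "nat \<Rightarrow> nat \<Rightarrow> (nat \<Rightarrow> nat \<Rightarrow> real) \<Rightarrow> real" where
  "mean_sq_norm n T x = (1 / real T) * (\<Sum>j<T. (L2_set (x j) {..<n})\<^sup>2)"

definition symm_tester ::
  "real \<Rightarrow> real \<Rightarrow> nat \<Rightarrow> real \<Rightarrow> (nat \<Rightarrow> nat \<Rightarrow> real) \<Rightarrow> verdict" where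
  "symm_tester c C n \<epsilon> x =
     (if mean_sq_norm n (num_samples C n \<epsilon>) x \<ge> real n - c * \<epsilon> / 2
      then Untruncated else Truncated)"

text \<open>The samples \<open>x j\<close>, \<open>j < num_samples C n \<epsilon>\<close>, are drawn independently from \<open>D\<close>.\<close>

definition symm_tester_prob ::
  "real \<Rightarrow> real \<Rightarrow> nat \<Rightarrow> real \<Rightarrow> (nat \<Rightarrow> real) measure \<Rightarrow> verdict \<Rightarrow> real" where
  "symm_tester_prob c C n \<epsilon> D v =
     \<P>(x in PiM {..<num_samples C n \<epsilon>} (\<lambda>_. D). symm_tester c C n \<epsilon> x = v)"

end

theory Submission imports Defs begin

text \<open>
  Let \<open>\<gamma>\<close> be the standard Gaussian and \<open>G t = \<gamma> (t K)\<close>. With \<open>s\<^sup>2 = 1 - 2 \<tau>\<close>, a change of variables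
  shows that \<open>exp (\<tau> * |x|\<^sup>2)\<close> has expectation \<open>G s / (s ^ n * G 1)\<close> under \<open>\<gamma>\<close> conditioned on \<open>K\<close>. Both error
  probabilities are therefore Chernoff bounds, once the dilation inequality
  \<open>G 1 - G s \<ge> (1 - s) * G s * (1 - G 1) / 16\<close> is known; it replaces both the mean and the variance bound.

  For the dilation inequality let \<open>r\<close> be a lower bound for the width of \<open>K\<close>, so that every supporting
  halfspace \<open>\<langle>a, x\<rangle> \<le> h\<close>, \<open>|a| = 1\<close>, has \<open>h \<ge> r\<close>. Follow \<open>x cos \<theta> + y sin \<theta>\<close> for independent Gaussian \<open>x, y\<close>
  and \<open>0 \<le> \<theta> \<le> \<alpha>\<close>. Its law is rotation invariant, and in a short step the gauge of \<open>K\<close> decreases by at most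
  a one-dimensional Gaussian increment over \<open>r\<close>. Hence the probability of starting in \<open>s K\<close> and ending outside
  \<open>K\<close> is at most \<open>(G 1 - G s) * \<alpha> / (r * (1 - s))\<close>. If \<open>r\<close> can be taken of constant size, choose \<open>\<alpha> = \<pi> / 2\<close>:
  the endpoints are independent. Otherwise \<open>K\<close> lies in a slab of width of order \<open>r\<close>, and an arc of length of
  order \<open>r\<close> already leaves it with probability at least one half.
\<close>

section \<open>Separation of convex sets\<close>

definition dotp :: "nat \<Rightarrow> (nat \<Rightarrow> real) \<Rightarrow> (nat \<Rightarrow> real) \<Rightarrow> real" where
  "dotp n a x = (\<Sum>i<n. a i * x i)"

lemma dotp_scale_right: "dotp n a (\<lambda>i. u * x i) = u * dotp n a x"
  by (simp add: dotp_def sum_distrib_left algebra_simps)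

lemma dotp_self_nonneg: "0 \<le> dotp n a a"
  by (simp add: dotp_def sum_nonneg)

lemma continuous_on_dotp: "continuous_on S (\<lambda>a. dotp n a x)" "continuous_on S (\<lambda>a. dotp n a a)"
  unfolding dotp_def
  by (intro continuous_intros continuous_on_subset[OF continuous_on_product_coordinates]; simp)+

text \<open>Stated on total functions, without the \<open>restrict\<close> of
  \<open>convex_Rn\<close>, so that all arithmetic is plainly pointwise. A body in \<real>^n enters
  as the cylinder over it.\<close>

definition convex_fun_set :: "('a \<Rightarrow> real) set \<Rightarrow> bool" where
  "convex_fun_set K \<longleftrightarrow>
     (\<forall>x\<in>K. \<forall>y\<in>K. \<forall>u\<ge>0. \<forall>v\<ge>0. u + v = 1 \<longrightarrow> (\<lambda>i. u * x i + v * y i) \<in> K)"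

lemma convex_fun_setD:
  "convex_fun_set K \<Longrightarrow> x \<in> K \<Longrightarrow> y \<in> K \<Longrightarrow> 0 \<le> u \<Longrightarrow> 0 \<le> v \<Longrightarrow> u + v = 1 \<Longrightarrow>
    (\<lambda>i. u * x i + v * y i) \<in> K"
  by (simp add: convex_fun_set_def)

lemma convex_fun_set_sum:
  assumes K: "convex_fun_set K"
  assumes F: "finite F" "F \<subseteq> K" and l: "\<And>k. k \<in> F \<Longrightarrow> 0 \<le> l k" "sum l F = 1"
  shows "(\<lambda>i. \<Sum>k\<in>F. l k * k i) \<in> K"
  using F l
proof (induction F arbitrary: l rule: finite_induct)
  case empty
  then show ?case by simp
next
  case (insert k F)
  show ?case
  proof (cases "sum l F = 0")
    case True
    then have "\<forall>j\<in>F. l j = 0"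
      using insert by (subst (asm) sum_nonneg_eq_0_iff) auto
    moreover from True insert have "l k = 1" by simp
    ultimately show ?thesis using insert by simp
  next
    case False
    \<comment> \<open>The remaining weights are renormalised by \<open>s\<close> so that the
      induction hypothesis applies to them.\<close>
    define s where "s = sum l F"
    have s: "s > 0" using False insert.prems by (simp add: s_def less_le sum_nonneg)
    have "(\<lambda>i. \<Sum>j\<in>F. l j / s * j i) \<in> K"
      using insert.prems s by (intro insert.IH) (auto simp: s_def simp flip: sum_divide_distrib)
    then have "(\<lambda>i. l k * k i + s * (\<Sum>j\<in>F. l j / s * j i)) \<in> K"
      using insert s by (intro convex_fun_setD[OF K]) (auto simp: s_def)
    then show ?thesis
      using insert s by (simp add: sum_distrib_left)
  qed
qed

text \<open>Tychonoff for the product topology. In both applications the index type is infinite, and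
  coordinates outside the relevant finite set are pinned to \<open>{0}\<close>.\<close>

lemma compact_fun_box:
  fixes B :: "'a \<Rightarrow> real set"
  assumes "\<And>i. compact (B i)"
  shows "compact {f. \<forall>i. f i \<in> B i}"
proof -
  have "compactin (product_topology (\<lambda>i. euclidean) UNIV) (PiE UNIV B)"
    using assms by (subst compactin_PiE) (auto simp: compactin_euclidean_iff)
  also have "PiE UNIV B = {f. \<forall>i. f i \<in> B i}"
    by auto
  finally show ?thesis
    by (simp add: euclidean_product_topology compactin_euclidean_iff)
qed

text \<open>The convex hull of \<open>F\<close> is compact, so it has a point \<open>a\<close> of
  least norm. As a point of \<open>K\<close> it is nonzero, and minimality along the segment from
  \<open>a\<close> to \<open>k\<close> forces
  \<open>dotp n a k \<ge> dotp n a a > 0\<close>.\<close>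

lemma finite_halfspace_witness:
  assumes K: "convex_fun_set K" and F: "finite F" "F \<subseteq> K"
    and nz: "\<And>k. k \<in> K \<Longrightarrow> \<exists>i<n. k i \<noteq> 0" and n: "n > 0"
  shows "\<exists>a. (\<forall>i\<ge>n. a i = 0) \<and> dotp n a a = 1 \<and> (\<forall>k\<in>F. 0 \<le> dotp n a k)"
proof (cases "F = {}")
  case True
  show ?thesis
    by (rule exI[of _ "\<lambda>i. if i = 0 then 1 else 0"])
      (use True n in \<open>auto simp: dotp_def if_distrib[of "\<lambda>x. x * _"] sum.delta cong: if_cong\<close>)
next
  case False
  \<comment> \<open>The simplex of weights on \<open>F\<close>; \<open>comb\<close> maps a weight to
    the corresponding point of the convex hull.\<close>
  define S where "S = {l. \<forall>k. l k \<in> (if k \<in> F then {0..1::real} else {0})} \<inter> {l. sum l F = 1}"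
  define comb where "comb l i = (\<Sum>k\<in>F. l k * k i)" for l i
  have "closed {l::(nat \<Rightarrow> real) \<Rightarrow> real. sum l F = 1}"
    by (intro closed_Collect_eq continuous_intros continuous_on_product_coordinates)
  then have "compact S"
    unfolding S_def by (intro compact_Int_closed compact_fun_box) auto
  moreover obtain k0 where k0: "k0 \<in> F" using False by blast
  then have "(\<lambda>k. if k = k0 then 1 else 0) \<in> S"
    using F by (auto simp: S_def)
  then have "S \<noteq> {}" by blast
  moreover have "continuous_on S (\<lambda>l. dotp n (comb l) (comb l))"
    unfolding dotp_def comb_def
    by (intro continuous_intros continuous_on_subset[OF continuous_on_product_coordinates]; simp)
  ultimately obtain l where l: "l \<in> S"
    and min: "\<And>l'. l' \<in> S \<Longrightarrow> dotp n (comb l) (comb l) \<le> dotp n (comb l') (comb l')"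
    using continuous_attains_inf[of S "\<lambda>l. dotp n (comb l) (comb l)"] by blast
  define a where "a = comb l"
  have "a \<in> K"
    unfolding a_def comb_def using l F
    by (intro convex_fun_set_sum[OF K]) (auto simp: S_def split: if_splits dest: spec)
  then obtain i0 where "i0 < n" "a i0 \<noteq> 0" using nz by blast
  then have apos: "dotp n a a > 0"
    unfolding dotp_def by (intro sum_pos2[of _ i0]) (auto simp: zero_less_mult_iff linorder_neq_iff)
  have "dotp n a a \<le> dotp n a k" if k: "k \<in> F" for k
  proof (rule ccontr)
    assume neg: "\<not> dotp n a a \<le> dotp n a k"
    define b where "b = (\<lambda>i. k i - a i)"
    have ab: "dotp n a b < 0"
      using neg by (simp add: b_def dotp_def algebra_simps sum_subtractf)
    \<comment> \<open>The change of the squared norm when \<open>a\<close> moves by the fraction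
      \<open>t\<close> towards \<open>k\<close>. The weights \<open>l'\<close> show that the moved
      point is still in the hull.\<close>
    have quad: "0 \<le> 2 * t * dotp n a b + t\<^sup>2 * dotp n b b" if t: "0 \<le> t" "t \<le> 1" for t
    proof -
      define l' where "l' j = (1 - t) * l j + t * (if j = k then 1 else 0)" for j
      have "l' \<in> S"
      proof -
        have "l' j \<in> (if j \<in> F then {0..1} else {0})" for j
        proof (cases "j \<in> F")
          case True
          then have lj: "0 \<le> l j" "l j \<le> 1" using l by (auto simp: S_def split: if_splits)
          have "(1 - t) * l j \<le> (1 - t) * 1" using lj t by (intro mult_left_mono) auto
          then show ?thesis using True lj t by (auto simp: l'_def intro!: add_nonneg_nonneg mult_nonneg_nonneg)
        next
          case False
          then show ?thesis using l k by (auto simp: S_def l'_def split: if_splits)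
        qed
        moreover have "sum l' F = 1"
        proof -
          have "sum l' F = (1 - t) * sum l F + t * (\<Sum>j\<in>F. if j = k then 1 else 0)"
            unfolding l'_def by (simp only: sum.distrib sum_distrib_left)
          then show ?thesis using l k F by (simp add: S_def)
        qed
        ultimately show ?thesis by (simp add: S_def)
      qed
      have "comb l' = (\<lambda>i. a i + t * b i)"
      proof
        fix i
        have "comb l' i = (1 - t) * comb l i + t * (\<Sum>j\<in>F. if j = k then j i else 0)"
          unfolding comb_def l'_def sum_distrib_left sum.distrib[symmetric]
          by (intro sum.cong refl) (simp add: algebra_simps)
        then show "comb l' i = a i + t * b i"
          using k F by (simp add: a_def b_def algebra_simps)
      qed
      then have "dotp n (comb l') (comb l') = dotp n a a + (2 * t * dotp n a b + t\<^sup>2 * dotp n b b)"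
        by (simp add: dotp_def algebra_simps sum.distrib sum_distrib_left power2_eq_square)
      then show ?thesis using min[OF \<open>l' \<in> S\<close>] by (simp add: a_def)
    qed
    \<comment> \<open>A step so short that the linear term, negative by assumption, beats the
      quadratic one. The summand 1 keeps the denominator positive and makes the inequality
      strict.\<close>
    define t where "t = min 1 (- dotp n a b / (dotp n b b + 1))"
    have bb: "0 \<le> dotp n b b" by (rule dotp_self_nonneg)
    have t: "0 < t" "t \<le> 1" using ab bb by (auto simp: t_def intro!: divide_neg_pos)
    have "t * (dotp n b b + 1) \<le> - dotp n a b"
    proof -
      have "t \<le> - dotp n a b / (dotp n b b + 1)" by (simp add: t_def)
      then show ?thesis using bb by (subst (asm) pos_le_divide_eq) auto
    qed
    then have "t * (t * dotp n b b) \<le> t * (- dotp n a b - t)"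
      using t by (intro mult_left_mono) (auto simp: algebra_simps)
    moreover have "t * t > 0" using t by simp
    moreover have "t * dotp n a b < 0" using t ab by (simp add: mult_pos_neg)
    ultimately show False
      using quad[of t] t unfolding power2_eq_square by (simp only: mult.assoc) (smt (verit) right_diff_distrib mult_minus_right)
  qed
  then have *: "0 \<le> dotp n a k" if "k \<in> F" for k
    using that apos by (meson less_le_not_le order_trans)
  define c where "c = sqrt (dotp n a a)"
  have c: "c > 0" "c * c = dotp n a a" using apos by (auto simp: c_def)
  show ?thesis
  proof (intro exI conjI)
    \<comment> \<open>Besides normalising, the coordinates from \<open>n\<close> on are set to 0, so
      that the witness lies in the compact sphere of \<open>weak_separation\<close>.\<close>
    let ?a = "\<lambda>i. if i < n then a i / c else 0"
    have d: "dotp n ?a x = dotp n a x / c" for x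
      by (simp add: dotp_def sum_divide_distrib)
    show "dotp n ?a ?a = 1"
      using c apos by (simp add: dotp_def sum_divide_distrib[symmetric])
    show "\<forall>k\<in>F. 0 \<le> dotp n ?a k"
      using * c by (simp add: d)
  qed auto
qed

text \<open>Each \<open>k\<close> restricts the unit normals \<open>a\<close> to the closed set
  where \<open>dotp n a (x - k) \<ge> 0\<close>. Finitely many of these sets meet by
  \<open>finite_halfspace_witness\<close>, so by compactness of the sphere all of them do.\<close>

lemma weak_separation:
  assumes K: "convex_fun_set K" and ext: "\<And>y. y \<in> K \<Longrightarrow> \<exists>i<n. y i \<noteq> x i" and n: "n > 0"
  shows "\<exists>a. dotp n a a = 1 \<and> (\<forall>k\<in>K. dotp n a k \<le> dotp n a x)"
proof -
  define L where "L = (\<lambda>k i. x i - k i) ` K"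
  have L: "convex_fun_set L"
    unfolding convex_fun_set_def L_def
  proof safe
    fix y z and u v :: real
    assume *: "y \<in> K" "z \<in> K" "0 \<le> u" "0 \<le> v" "u + v = 1"
    have "u * (x i - y i) + v * (x i - z i) = (u + v) * x i - (u * y i + v * z i)" for i
      by (simp add: algebra_simps)
    with * have "(\<lambda>i. u * (x i - y i) + v * (x i - z i)) = (\<lambda>i. x i - (\<lambda>i. u * y i + v * z i) i)"
      by simp
    then show "(\<lambda>i. u * (x i - y i) + v * (x i - z i)) \<in> (\<lambda>k i. x i - k i) ` K"
      using convex_fun_setD[OF K *] by (intro image_eqI) auto
  qed
  \<comment> \<open>The unit sphere in the first \<open>n\<close> coordinates; the others are fixed
    at 0 for compactness in the product topology.\<close>
  define S where "S = {a. \<forall>i. a i \<in> (if i < n then {-1..1::real} else {0})} \<inter> {a. dotp n a a = 1}"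
  have "closed {a. dotp n a a = 1}"
    by (intro closed_Collect_eq continuous_on_dotp continuous_intros)
  then have "compact S"
    unfolding S_def by (intro compact_Int_closed compact_fun_box) auto
  then have "S \<inter> (\<Inter>k\<in>L. {a. 0 \<le> dotp n a k}) \<noteq> {}"
  proof (rule compact_imp_fip_image)
    show "closed {a. 0 \<le> dotp n a k}" for k
      by (intro closed_Collect_le continuous_on_dotp continuous_intros)
    fix F assume F: "finite F" "F \<subseteq> L"
    obtain a where a: "\<forall>i\<ge>n. a i = 0" "dotp n a a = 1" "\<forall>k\<in>F. 0 \<le> dotp n a k"
      using finite_halfspace_witness[OF L F _ n] ext by (fastforce simp: L_def)
    have "a i \<in> {-1..1}" if "i < n" for i
    proof -
      have "(a i)\<^sup>2 \<le> dotp n a a"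
        unfolding dotp_def power2_eq_square using that by (intro member_le_sum) auto
      then show ?thesis using a(2) by (simp add: abs_square_le_1 flip: abs_le_iff) (simp add: abs_le_iff)
    qed
    with a have "a \<in> S \<inter> (\<Inter>k\<in>F. {a. 0 \<le> dotp n a k})"
      by (auto simp: S_def)
    then show "S \<inter> (\<Inter>k\<in>F. {a. 0 \<le> dotp n a k}) \<noteq> {}" by blast
  qed
  then obtain a where "dotp n a a = 1" "\<And>k. k \<in> L \<Longrightarrow> 0 \<le> dotp n a k"
    by (auto simp: S_def)
  then show ?thesis
    by (intro exI[of _ a]) (force simp: L_def dotp_def algebra_simps sum_subtractf)
qed

section \<open>Product measures\<close>

text \<open>Both measures agree on boxes: there the integrand is a product of functions of separate
  coordinates, and its integral factorises.\<close>

lemma PiM_density: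
  fixes M :: "'i \<Rightarrow> 'a measure" and f :: "'i \<Rightarrow> 'a \<Rightarrow> ennreal"
  assumes I: "finite I" and sf: "\<And>i. sigma_finite_measure (M i)"
    and sf': "\<And>i. sigma_finite_measure (density (M i) (f i))"
    and f[measurable]: "\<And>i. f i \<in> borel_measurable (M i)"
  shows "PiM I (\<lambda>i. density (M i) (f i)) = density (PiM I M) (\<lambda>x. \<Prod>i\<in>I. f i (x i))"
proof (rule sym, rule product_sigma_finite.PiM_eqI)
  interpret product_sigma_finite M by (rule product_sigma_finite.intro) (rule sf)
  show "product_sigma_finite (\<lambda>i. density (M i) (f i))"
    by (rule product_sigma_finite.intro) (rule sf')
  show "finite I" by fact
  show "sets (density (PiM I M) (\<lambda>x. \<Prod>i\<in>I. f i (x i))) = sets (PiM I (\<lambda>i. density (M i) (f i)))"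
    by (simp cong: sets_PiM_cong)
  fix A assume A: "\<And>i. i \<in> I \<Longrightarrow> A i \<in> sets (density (M i) (f i))"
  then have A'[measurable]: "\<And>i. i \<in> I \<Longrightarrow> A i \<in> sets (M i)" by simp
  have [measurable]: "Pi\<^sub>E I A \<in> sets (PiM I M)" "(\<lambda>x. \<Prod>i\<in>I. f i (x i)) \<in> borel_measurable (PiM I M)"
    using I A' by (auto intro!: sets_PiM_I_finite)
  have "emeasure (density (PiM I M) (\<lambda>x. \<Prod>i\<in>I. f i (x i))) (Pi\<^sub>E I A)
      = (\<integral>\<^sup>+x. (\<Prod>i\<in>I. f i (x i)) * indicator (Pi\<^sub>E I A) x \<partial>PiM I M)"
    by (simp add: emeasure_density)
  also have "\<dots> = (\<integral>\<^sup>+x. (\<Prod>i\<in>I. f i (x i) * indicator (A i) (x i)) \<partial>PiM I M)"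
  proof (rule nn_integral_cong)
    fix x assume "x \<in> space (PiM I M)"
    then have "x \<in> extensional I" by (simp add: space_PiM PiE_def)
    then have "indicator (Pi\<^sub>E I A) x = (\<Prod>i\<in>I. indicator (A i) (x i) :: ennreal)"
      using I by (auto simp: indicator_def PiE_iff prod_zero_iff)
    then show "(\<Prod>i\<in>I. f i (x i)) * indicator (Pi\<^sub>E I A) x = (\<Prod>i\<in>I. f i (x i) * indicator (A i) (x i))"
      by (simp add: prod.distrib)
  qed
  also have "\<dots> = (\<Prod>i\<in>I. \<integral>\<^sup>+x. f i x * indicator (A i) x \<partial>M i)"
    using I by (intro product_nn_integral_prod) auto
  also have "\<dots> = (\<Prod>i\<in>I. emeasure (density (M i) (f i)) (A i))"
    by (intro prod.cong refl) (simp add: emeasure_density)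
  finally show "emeasure (density (PiM I M) (\<lambda>x. \<Prod>i\<in>I. f i (x i))) (Pi\<^sub>E I A) =
    (\<Prod>i\<in>I. emeasure (density (M i) (f i)) (A i))" .
qed

text \<open>These are the side conditions for proving equality of measures on boxes only.\<close>

lemma PiM_box_generator:
  fixes I :: "'i set" and Q :: "'i \<Rightarrow> 'a measure"
  assumes I: "finite I"
  defines "E \<equiv> {Pi\<^sub>E I A | A. \<forall>i\<in>I. A i \<in> sets (Q i)}"
  shows "E \<subseteq> Pow (space (PiM I Q))" "sets (PiM I Q) = sigma_sets (space (PiM I Q)) E"
    "space (PiM I Q) \<in> E" "Int_stable E"
proof -
  have eq: "prod_algebra I Q = E"
    unfolding E_def prod_algebra_eq_finite[OF I] by (auto simp: Pi_iff)
  show "E \<subseteq> Pow (space (PiM I Q))"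
    unfolding eq[symmetric] space_PiM by (rule prod_algebra_sets_into_space)
  show "sets (PiM I Q) = sigma_sets (space (PiM I Q)) E"
    unfolding eq[symmetric] space_PiM by (rule sets_PiM)
  show "space (PiM I Q) \<in> E"
    unfolding E_def by (auto simp: space_PiM)
  show "Int_stable E"
    unfolding eq[symmetric] by (rule Int_stable_prod_algebra)
qed

section \<open>Pairs of product measures and products of pair measures\<close>

definition unzip :: "'i set \<Rightarrow> ('i \<Rightarrow> 'a \<times> 'b) \<Rightarrow> ('i \<Rightarrow> 'a) \<times> ('i \<Rightarrow> 'b)" where
  "unzip I w = (\<lambda>i\<in>I. fst (w i), \<lambda>i\<in>I. snd (w i))"

text \<open>Products of two boxes form an intersection-stable generator. The preimage of such a set
  is the box with sides \<open>A i \<times> B i\<close>, and both measures give it the same product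
  of masses.\<close>

lemma distr_PiM_pair_unzip:
  fixes I :: "'i set" and M :: "'i \<Rightarrow> 'a measure" and N :: "'i \<Rightarrow> 'b measure"
  assumes I: "finite I" and M: "\<And>i. prob_space (M i)" and N: "\<And>i. prob_space (N i)"
  shows "distr (PiM I (\<lambda>i. M i \<Otimes>\<^sub>M N i)) (PiM I M \<Otimes>\<^sub>M PiM I N) (unzip I) = PiM I M \<Otimes>\<^sub>M PiM I N"
    (is "?P = _")
proof -
  interpret M: product_prob_space M by (rule product_prob_spaceI) (rule M)
  interpret N: product_prob_space N by (rule product_prob_spaceI) (rule N)
  have MN: "prob_space (M i \<Otimes>\<^sub>M N i)" for i
    by (intro prob_space_pair M N)
  interpret MN: product_prob_space "\<lambda>i. M i \<Otimes>\<^sub>M N i" by (rule product_prob_spaceI) (rule MN)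
  have P: "prob_space (PiM I (\<lambda>i. M i \<Otimes>\<^sub>M N i))" by (rule prob_space_PiM) (rule MN)
  have PN: "prob_space (PiM I N)" by (rule prob_space_PiM) (rule N)
  have meas[measurable]: "unzip I \<in> PiM I (\<lambda>i. M i \<Otimes>\<^sub>M N i) \<rightarrow>\<^sub>M PiM I M \<Otimes>\<^sub>M PiM I N"
    unfolding unzip_def by measurable
  define EM EN where "EM = {Pi\<^sub>E I A | A. \<forall>i\<in>I. A i \<in> sets (M i)}"
    and "EN = {Pi\<^sub>E I A | A. \<forall>i\<in>I. A i \<in> sets (N i)}"
  note gM = PiM_box_generator[OF I, of M, folded EM_def]
  note gN = PiM_box_generator[OF I, of N, folded EN_def]
  define E \<Omega> where "E = {a \<times> b | a b. a \<in> EM \<and> b \<in> EN}"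
    and "\<Omega> = space (PiM I M) \<times> space (PiM I N)"
  have sets: "sets (PiM I M \<Otimes>\<^sub>M PiM I N) = sets (sigma \<Omega> E)"
    unfolding E_def \<Omega>_def
    by (rule sets_pair_eq[where Ca="{space (PiM I M)}" and Cb="{space (PiM I N)}"])
      (use gM gN in simp_all)
  have sub: "E \<subseteq> Pow \<Omega>" using gM gN unfolding E_def \<Omega>_def by blast
  have \<Omega>: "\<Omega> \<in> E" using gM gN unfolding E_def \<Omega>_def by blast
  show ?thesis
  proof (rule measure_eqI_generator_eq[where E="E" and \<Omega>="\<Omega>" and A="\<lambda>_. \<Omega>"])
    show "Int_stable E"
    proof (rule Int_stableI)
      fix X Y assume "X \<in> E" "Y \<in> E"
      then obtain a b c d where *: "X = a \<times> b" "Y = c \<times> d" "a \<in> EM" "b \<in> EN" "c \<in> EM" "d \<in> EN"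
        unfolding E_def by blast
      have "X \<inter> Y = (a \<inter> c) \<times> (b \<inter> d)" using * by blast
      moreover have "a \<inter> c \<in> EM" "b \<inter> d \<in> EN"
        using gM(4) gN(4) * by (auto simp only: Int_stable_def)
      ultimately show "X \<inter> Y \<in> E" unfolding E_def by blast
    qed
    show "E \<subseteq> Pow \<Omega>" by (rule sub)
    show "sets ?P = sigma_sets \<Omega> E" "sets (PiM I M \<Otimes>\<^sub>M PiM I N) = sigma_sets \<Omega> E"
      using sets sub by simp_all
    show "range (\<lambda>_. \<Omega>) \<subseteq> E" using \<Omega> by blast
    show "(\<Union>i. \<Omega>) = \<Omega>" by simp
    show "emeasure ?P \<Omega> \<noteq> \<infinity>" for i :: nat
      using prob_space.finite_measure[OF prob_space.prob_space_distr[OF P meas], THEN finite_measure.emeasure_finite, of \<Omega>]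
      by (simp add: infinity_ennreal_def)
    fix X assume "X \<in> E"
    then obtain A B where X: "X = Pi\<^sub>E I A \<times> Pi\<^sub>E I B"
      and A[measurable]: "\<And>i. i \<in> I \<Longrightarrow> A i \<in> sets (M i)" and B[measurable]: "\<And>i. i \<in> I \<Longrightarrow> B i \<in> sets (N i)"
      unfolding E_def EM_def EN_def by blast
    have Am[measurable]: "Pi\<^sub>E I A \<in> sets (PiM I M)" "Pi\<^sub>E I B \<in> sets (PiM I N)"
      using I by (auto intro!: sets_PiM_I_finite)
    have "unzip I -` X \<inter> space (PiM I (\<lambda>i. M i \<Otimes>\<^sub>M N i)) = Pi\<^sub>E I (\<lambda>i. A i \<times> B i)"
      using A[THEN sets.sets_into_space] B[THEN sets.sets_into_space]
      by (auto simp: X unzip_def space_PiM PiE_iff space_pair_measure mem_Times_iff) blast+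
    then have "emeasure ?P X = emeasure (PiM I (\<lambda>i. M i \<Otimes>\<^sub>M N i)) (Pi\<^sub>E I (\<lambda>i. A i \<times> B i))"
      using X Am by (subst emeasure_distr) auto
    also have "\<dots> = (\<Prod>i\<in>I. emeasure (M i) (A i) * emeasure (N i) (B i))"
      using I A B by (subst MN.emeasure_PiM) (auto intro!: prod.cong
          sigma_finite_measure.emeasure_pair_measure_Times prob_space_imp_sigma_finite N)
    also have "\<dots> = emeasure (PiM I M) (Pi\<^sub>E I A) * emeasure (PiM I N) (Pi\<^sub>E I B)"
      using I A B by (simp add: prod.distrib M.emeasure_PiM N.emeasure_PiM)
    also have "\<dots> = emeasure (PiM I M \<Otimes>\<^sub>M PiM I N) X"
      using Am by (simp add: X sigma_finite_measure.emeasure_pair_measure_Times[OF prob_space_imp_sigma_finite[OF PN]])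
    finally show "emeasure ?P X = emeasure (PiM I M \<Otimes>\<^sub>M PiM I N) X" .
  qed
qed

section \<open>Rotation invariance of the planar Gaussian\<close>

abbreviation std_normal :: "real measure" where
  "std_normal \<equiv> density lborel (\<lambda>x. ennreal (std_normal_density x))"

lemma prob_space_std_normal: "prob_space std_normal"
  by (rule prob_space_normal_density) simp

text \<open>The second component is the first one at the angle \<open>\<theta> + pi/2\<close>, which
  is how the pair of arcs in \<open>distr_gauss_rotate\<close> arises.\<close>

definition rot2 :: "real \<Rightarrow> real \<times> real \<Rightarrow> real \<times> real" where
  "rot2 \<theta> z = (cos \<theta> * fst z + sin \<theta> * snd z, cos \<theta> * snd z - sin \<theta> * fst z)"

text \<open>Two one-dimensional affine substitutions with an exchange of integrals in between
  replace the planar change of variables. Their Jacobians \<open>1 / \<bar>s\<bar>\<close> and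
  \<open>\<bar>s\<bar>\<close> cancel, and the density depends on
  \<open>x\<^sup>2 + y\<^sup>2\<close> only.\<close>

lemma nn_integral_rotate_std_normal:
  fixes h :: "real \<times> real \<Rightarrow> ennreal"
  assumes h[measurable]: "h \<in> borel_measurable (borel \<Otimes>\<^sub>M borel)" and s: "sin \<theta> \<noteq> 0"
  shows "(\<integral>\<^sup>+x. \<integral>\<^sup>+y. h (rot2 \<theta> (x, y)) * ennreal (std_normal_density x * std_normal_density y) \<partial>lborel \<partial>lborel)
       = (\<integral>\<^sup>+x. \<integral>\<^sup>+y. h (x, y) * ennreal (std_normal_density x * std_normal_density y) \<partial>lborel \<partial>lborel)"
proof -
  define c s where "c = cos \<theta>" and "s = sin \<theta>"
  have s: "s \<noteq> 0" and cs: "c * c + s * s = 1"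
    using s by (simp_all add: c_def s_def flip: power2_eq_square)
  have h'[measurable]: "case_prod (\<lambda>x y. h (x, y)) \<in> borel_measurable (borel \<Otimes>\<^sub>M borel)"
    by simp
  define g where "g x y = std_normal_density x * std_normal_density y" for x y
  have g_eq: "g x y = exp (- (x\<^sup>2 + y\<^sup>2) / 2) / (2 * pi)" for x y
    by (simp add: g_def std_normal_density_def exp_add[symmetric] add_divide_distrib[symmetric] minus_add_distrib)
  have [measurable]: "(\<lambda>z. g (fst z) (snd z)) \<in> borel_measurable (borel \<Otimes>\<^sub>M borel)"
    unfolding g_def by measurable
  \<comment> \<open>For fixed \<open>x\<close>, the substitution
    \<open>u = c * x + s * y\<close>.\<close>
  have step1: "(\<integral>\<^sup>+y. h (c * x + s * y, c * y - s * x) * ennreal (g x y) \<partial>lborel)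
      = ennreal \<bar>1/s\<bar> * (\<integral>\<^sup>+u. h (u, (c * u - x) / s) * ennreal (g x ((u - c * x) / s)) \<partial>lborel)" for x
  proof -
    have e1: "c * x + s * (- (c * x / s) + 1 / s * u) = u" for u
      using s by (simp add: field_simps)
    have e2: "c * (- (c * x / s) + 1 / s * u) - s * x = (c * u - x) / s" for u
    proof -
      have "c * (- (c * x / s) + 1 / s * u) - s * x = (c * u - (c * c + s * s) * x) / s"
        using s by (simp add: field_simps)
      then show ?thesis by (simp add: cs)
    qed
    have e3: "- (c * x / s) + 1 / s * u = (u - c * x) / s" for u
      using s by (simp add: field_simps)
    have "(\<integral>\<^sup>+y. h (c * x + s * y, c * y - s * x) * ennreal (g x y) \<partial>lborel)
       = ennreal \<bar>1/s\<bar> * (\<integral>\<^sup>+u. h (c * x + s * (- (c * x / s) + 1 / s * u), c * (- (c * x / s) + 1 / s * u) - s * x)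
            * ennreal (g x (- (c * x / s) + 1 / s * u)) \<partial>lborel)"
      using s by (intro nn_integral_real_affine) (auto simp: g_def)
    then show ?thesis
      unfolding e1 e2 unfolding e3 .
  qed
  \<comment> \<open>For fixed \<open>u\<close>, the substitution \<open>x = c * u - s * v\<close>;
    it turns the second argument into \<open>v\<close> and restores the density.\<close>
  have step2: "(\<integral>\<^sup>+x. h (u, (c * u - x) / s) * ennreal (g x ((u - c * x) / s)) \<partial>lborel)
     = ennreal \<bar>s\<bar> * (\<integral>\<^sup>+v. h (u, v) * ennreal (g u v) \<partial>lborel)" for u
  proof -
    have e1: "(c * u - (c * u + (-s) * v)) / s = v" for v
      using s by simp
    have e2: "g (c * u + (-s) * v) ((u - c * (c * u + (-s) * v)) / s) = g u v" for v
    proof -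
      have "u - c * (c * u + (-s) * v) = (c * c + s * s) * u - c * (c * u + (-s) * v)" by (simp add: cs)
      also have "\<dots> = s * (s * u + c * v)" by (simp add: algebra_simps)
      finally have *: "(u - c * (c * u + (-s) * v)) / s = s * u + c * v"
        using s by simp
      have "(c * u + (-s) * v)\<^sup>2 + (s * u + c * v)\<^sup>2 = (c * c + s * s) * (u\<^sup>2 + v\<^sup>2)"
        by (simp add: power2_eq_square algebra_simps)
      then show ?thesis unfolding * g_eq cs by simp
    qed
    have "(\<integral>\<^sup>+x. h (u, (c * u - x) / s) * ennreal (g x ((u - c * x) / s)) \<partial>lborel)
      = ennreal \<bar>-s\<bar> * (\<integral>\<^sup>+v. h (u, (c * u - (c * u + (-s) * v)) / s) *
           ennreal (g (c * u + (-s) * v) ((u - c * (c * u + (-s) * v)) / s)) \<partial>lborel)"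
      using s by (intro nn_integral_real_affine) (auto simp: g_def)
    then show ?thesis unfolding e1 e2 by simp
  qed
  have "(\<integral>\<^sup>+x. \<integral>\<^sup>+y. h (rot2 \<theta> (x, y)) * ennreal (g x y) \<partial>lborel \<partial>lborel)
     = (\<integral>\<^sup>+x. ennreal \<bar>1/s\<bar> * (\<integral>\<^sup>+u. h (u, (c * u - x) / s) * ennreal (g x ((u - c * x) / s)) \<partial>lborel) \<partial>lborel)"
    by (simp add: rot2_def step1 flip: c_def s_def)
  also have "\<dots> = ennreal \<bar>1/s\<bar> * (\<integral>\<^sup>+x. \<integral>\<^sup>+u. h (u, (c * u - x) / s) * ennreal (g x ((u - c * x) / s)) \<partial>lborel \<partial>lborel)"
    unfolding g_def by (rule nn_integral_cmult) measurable
  also have "(\<integral>\<^sup>+x. \<integral>\<^sup>+u. h (u, (c * u - x) / s) * ennreal (g x ((u - c * x) / s)) \<partial>lborel \<partial>lborel)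
     = (\<integral>\<^sup>+u. \<integral>\<^sup>+x. h (u, (c * u - x) / s) * ennreal (g x ((u - c * x) / s)) \<partial>lborel \<partial>lborel)"
    unfolding g_def by (rule lborel_pair.Fubini') measurable
  also have "\<dots> = (\<integral>\<^sup>+u. ennreal \<bar>s\<bar> * (\<integral>\<^sup>+v. h (u, v) * ennreal (g u v) \<partial>lborel) \<partial>lborel)"
    by (simp add: step2)
  also have "\<dots> = ennreal \<bar>s\<bar> * (\<integral>\<^sup>+u. \<integral>\<^sup>+v. h (u, v) * ennreal (g u v) \<partial>lborel \<partial>lborel)"
    unfolding g_def by (rule nn_integral_cmult) measurable
  also have "ennreal \<bar>1/s\<bar> * (ennreal \<bar>s\<bar> * X) = X" for X
    using s by (simp add: mult.assoc[symmetric] ennreal_mult'[symmetric])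
  finally show ?thesis by (simp add: g_def)
qed

lemma distr_rot2_std_normal:
  "distr (std_normal \<Otimes>\<^sub>M std_normal) (std_normal \<Otimes>\<^sub>M std_normal) (rot2 \<theta>) = std_normal \<Otimes>\<^sub>M std_normal"
  (is "distr ?M ?M _ = ?M")
proof -
  interpret N: prob_space std_normal by (rule prob_space_std_normal)
  have rot[measurable]: "rot2 t \<in> borel \<Otimes>\<^sub>M borel \<rightarrow>\<^sub>M borel \<Otimes>\<^sub>M borel" for t
    unfolding rot2_def by measurable
  have [measurable_cong]: "sets ?M = sets (borel \<Otimes>\<^sub>M borel)"
    by (intro sets_pair_measure_cong) auto
  have int: "(\<integral>\<^sup>+z. h z \<partial>?M) =
      (\<integral>\<^sup>+x. \<integral>\<^sup>+y. h (x, y) * ennreal (std_normal_density x * std_normal_density y) \<partial>lborel \<partial>lborel)"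
    if [measurable]: "h \<in> borel_measurable (borel \<Otimes>\<^sub>M borel)" for h
    by (subst N.nn_integral_fst[symmetric])
      (auto simp: nn_integral_density nn_integral_cmult[symmetric] ennreal_mult' mult_ac intro!: nn_integral_cong)
  have gen: "distr ?M ?M (rot2 t) = ?M" if t: "sin t \<noteq> 0" for t
  proof (rule measure_eqI)
    fix A assume "A \<in> sets (distr ?M ?M (rot2 t))"
    then have A[measurable]: "A \<in> sets (borel \<Otimes>\<^sub>M borel)" by simp
    have "emeasure (distr ?M ?M (rot2 t)) A = (\<integral>\<^sup>+z. indicator A (rot2 t z) \<partial>?M)"
      by (simp add: nn_integral_distr flip: nn_integral_indicator)
    also have "\<dots> = (\<integral>\<^sup>+z. indicator A z \<partial>?M)"
      by (simp add: int nn_integral_rotate_std_normal[OF _ t] del: nn_integral_indicator)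
    finally show "emeasure (distr ?M ?M (rot2 t)) A = emeasure ?M A" by simp
  qed simp
  show ?thesis
  proof (cases "sin \<theta> = 0")
    case False
    then show ?thesis by (rule gen)
  next
    case True
    \<comment> \<open>An angle with vanishing sine is split into \<open>pi/2\<close> and
      \<open>\<theta> - pi/2\<close>, both with nonzero sine.\<close>
    have "rot2 (pi/2) (rot2 (\<theta> - pi/2) z) = rot2 \<theta> z" for z
      by (simp add: rot2_def cos_diff sin_diff algebra_simps)
    then have "rot2 \<theta> = rot2 (pi/2) \<circ> rot2 (\<theta> - pi/2)" by auto
    moreover have "sin (\<theta> - pi/2) \<noteq> 0"
      using True sin_cos_squared_add[of \<theta>] by (auto simp: sin_diff)
    ultimately have "distr ?M ?M (rot2 \<theta>) = distr (distr ?M ?M (rot2 (\<theta> - pi/2))) ?M (rot2 (pi/2))"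
      by (simp add: distr_distr)
    also have "\<dots> = ?M"
      using \<open>sin (\<theta> - pi/2) \<noteq> 0\<close> by (simp add: gen)
    finally show ?thesis .
  qed
qed

section \<open>The standard Gaussian measure\<close>

text \<open>The measure on the product of the Borel \<sigma>-algebras; \<open>std_gaussian n\<close>
  is its completion. Products and sections are taken here, before completing.\<close>

definition gauss :: "nat \<Rightarrow> (nat \<Rightarrow> real) measure" where
  "gauss n = PiM {..<n} (\<lambda>_. std_normal)"

lemma prob_space_gauss: "prob_space (gauss n)"
  unfolding gauss_def by (rule prob_space_PiM) (rule prob_space_std_normal)

lemma sets_gauss [measurable_cong]: "sets (gauss n) = sets (PiM {..<n} (\<lambda>_. borel))"
  unfolding gauss_def by (intro sets_PiM_cong) auto

lemma space_gauss: "space (gauss n) = {..<n} \<rightarrow>\<^sub>E UNIV"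
  by (simp add: gauss_def space_PiM)

lemma measurable_gauss_component:
  assumes "f \<in> M \<rightarrow>\<^sub>M gauss n" "i \<in> {..<n}"
  shows "(\<lambda>w. f w i) \<in> borel_measurable M"
proof -
  have "(\<lambda>x. x i) \<in> borel_measurable (gauss n)"
    using assms(2) by measurable
  with assms(1) show ?thesis by (rule measurable_compose)
qed

lemma measurable_dotp [measurable]:
  assumes [measurable]: "f \<in> M \<rightarrow>\<^sub>M gauss n"
  shows "(\<lambda>w. dotp n a (f w)) \<in> borel_measurable M"
  unfolding dotp_def using measurable_gauss_component[OF assms] by measurable

lemma measurable_sum_squares [measurable]: "(\<lambda>x. \<Sum>i<n. (x i)\<^sup>2) \<in> borel_measurable (gauss n)"
  by measurable

section \<open>Rotating a pair of Gaussian vectors\<close>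

definition arc :: "nat \<Rightarrow> real \<Rightarrow> (nat \<Rightarrow> real) \<Rightarrow> (nat \<Rightarrow> real) \<Rightarrow> nat \<Rightarrow> real" where
  "arc n \<theta> x y = (\<lambda>i\<in>{..<n}. cos \<theta> * x i + sin \<theta> * y i)"

lemma measurable_arc [measurable]:
  assumes "f \<in> M \<rightarrow>\<^sub>M gauss n" "g \<in> M \<rightarrow>\<^sub>M gauss n"
  shows "(\<lambda>w. arc n \<theta> (f w) (g w)) \<in> M \<rightarrow>\<^sub>M gauss n"
  unfolding arc_def measurable_cong_sets[OF refl sets_gauss]
  using assms[THEN measurable_gauss_component] by measurable

text \<open>The points at angles \<open>\<theta>\<close> and \<open>\<theta> + pi/2\<close> form the
  rotated pair, and the arc of that pair continues the original one.\<close>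

lemma arc_arc: "arc n \<delta> (arc n \<theta> x y) (arc n (\<theta> + pi/2) x y) = arc n (\<theta> + \<delta>) x y"
  by (auto simp: arc_def fun_eq_iff cos_add sin_add algebra_simps)

lemma arc_0: "x \<in> space (gauss n) \<Longrightarrow> arc n 0 x y = x"
  by (auto simp: arc_def fun_eq_iff space_gauss PiE_def extensional_def)

lemma arc_pi_half: "y \<in> space (gauss n) \<Longrightarrow> arc n (pi/2) x y = y"
  by (auto simp: arc_def fun_eq_iff space_gauss PiE_def extensional_def)

lemma dotp_arc: "dotp n a (arc n \<theta> x y) = cos \<theta> * dotp n a x + sin \<theta> * dotp n a y"
  by (simp add: arc_def dotp_def sum_distrib_left algebra_simps sum.distrib)

text \<open>A pair of vectors is the same as a family of \<open>n\<close> independent planar points.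
  Rotating each of them by \<open>rot2\<close> keeps the law, and \<open>unzip\<close> carries this
  over to the pair.\<close>

lemma distr_gauss_rotate:
  "distr (gauss n \<Otimes>\<^sub>M gauss n) (gauss n \<Otimes>\<^sub>M gauss n)
     (\<lambda>z. (arc n \<theta> (fst z) (snd z), arc n (\<theta> + pi/2) (fst z) (snd z))) = gauss n \<Otimes>\<^sub>M gauss n"
  (is "distr ?G ?G ?r = _")
proof -
  let ?W = "PiM {..<n} (\<lambda>_. std_normal \<Otimes>\<^sub>M std_normal)"
  have G: "distr ?W ?G (unzip {..<n}) = ?G"
    unfolding gauss_def by (intro distr_PiM_pair_unzip prob_space_std_normal) simp
  have [measurable]: "unzip {..<n} \<in> ?W \<rightarrow>\<^sub>M ?G"
    unfolding unzip_def gauss_def by measurable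
  have rot[measurable]: "rot2 \<theta> \<in> std_normal \<Otimes>\<^sub>M std_normal \<rightarrow>\<^sub>M std_normal \<Otimes>\<^sub>M std_normal"
    unfolding rot2_def by measurable
  have [measurable]: "compose {..<n} (rot2 \<theta>) \<in> ?W \<rightarrow>\<^sub>M ?W"
    unfolding compose_def by measurable
  have pp: "prob_space (std_normal \<Otimes>\<^sub>M std_normal)"
    by (intro prob_space_pair prob_space_std_normal)
  have W: "distr ?W ?W (compose {..<n} (rot2 \<theta>)) = ?W"
    by (subst distr_PiM_finite_prob_space') (auto simp: pp distr_rot2_std_normal)
  have "distr ?G ?G ?r = distr (distr ?W ?G (unzip {..<n})) ?G ?r"
    by (simp only: G)
  also have "\<dots> = distr ?W ?G (?r \<circ> unzip {..<n})"
    by (intro distr_distr) measurable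
  also have "?r \<circ> unzip {..<n} = unzip {..<n} \<circ> compose {..<n} (rot2 \<theta>)"
    by (auto simp: fun_eq_iff arc_def unzip_def compose_def rot2_def cos_add sin_add)
  also have "distr ?W ?G \<dots> = distr (distr ?W ?W (compose {..<n} (rot2 \<theta>))) ?G (unzip {..<n})"
    by (intro distr_distr[symmetric]) measurable
  also have "\<dots> = ?G" by (simp only: W G)
  finally show ?thesis .
qed

text \<open>Stationarity: two points of the arc at angular distance \<open>\<delta>\<close> have the
  same joint law wherever the first one lies.\<close>

lemma nn_integral_gauss_rotate:
  assumes F[measurable]: "(\<lambda>z. F (fst z) (snd z)) \<in> borel_measurable (gauss n \<Otimes>\<^sub>M gauss n)"
  shows "(\<integral>\<^sup>+z. F (arc n \<theta> (fst z) (snd z)) (arc n (\<theta> + \<delta>) (fst z) (snd z)) \<partial>(gauss n \<Otimes>\<^sub>M gauss n))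
       = (\<integral>\<^sup>+z. F (fst z) (arc n \<delta> (fst z) (snd z)) \<partial>(gauss n \<Otimes>\<^sub>M gauss n))"
proof -
  have F'[measurable]: "(\<lambda>z. F (fst z) (arc n \<delta> (fst z) (snd z))) \<in> borel_measurable (gauss n \<Otimes>\<^sub>M gauss n)"
    using measurable_compose[OF _ F, of "\<lambda>z. (fst z, arc n \<delta> (fst z) (snd z))" "gauss n \<Otimes>\<^sub>M gauss n"]
    by simp
  show ?thesis
    by (subst (2) distr_gauss_rotate[of n \<theta>, symmetric], subst nn_integral_distr) (simp_all add: arc_arc)
qed

lemma distr_arc: "distr (gauss n \<Otimes>\<^sub>M gauss n) (gauss n) (\<lambda>z. arc n \<theta> (fst z) (snd z)) = gauss n"
proof -
  interpret prob_space "gauss n" by (rule prob_space_gauss)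
  let ?G = "gauss n \<Otimes>\<^sub>M gauss n"
  have "distr ?G (gauss n) (\<lambda>z. arc n \<theta> (fst z) (snd z)) = distr (distr ?G ?G
     (\<lambda>z. (arc n \<theta> (fst z) (snd z), arc n (\<theta> + pi/2) (fst z) (snd z)))) (gauss n) fst"
    by (subst distr_distr) (simp_all add: comp_def)
  also have "\<dots> = gauss n"
    unfolding distr_gauss_rotate by (rule distr_pair_fst)
  finally show ?thesis .
qed

section \<open>Dilations of the Gaussian measure\<close>

lemma distr_std_normal_shrink:
  assumes t: "t > 0"
  shows "distr std_normal std_normal (\<lambda>x. x / t) =
    density std_normal (\<lambda>u. ennreal (t * exp ((1 - t\<^sup>2) / 2 * u\<^sup>2)))"
proof (rule measure_eqI)
  fix A assume "A \<in> sets (distr std_normal std_normal (\<lambda>x. x / t))"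
  then have [measurable]: "A \<in> sets borel" by simp
  have d: "std_normal_density (t * u) = std_normal_density u * exp ((1 - t\<^sup>2) / 2 * u\<^sup>2)" for u
    by (simp add: std_normal_density_def mult_exp_exp power_mult_distrib field_simps)
  have "emeasure (distr std_normal std_normal (\<lambda>x. x / t)) A
      = (\<integral>\<^sup>+x. ennreal (std_normal_density x) * indicator A (x / t) \<partial>lborel)"
    by (simp add: nn_integral_distr nn_integral_density flip: nn_integral_indicator)
  also have "\<dots> = ennreal \<bar>t\<bar> * (\<integral>\<^sup>+u. ennreal (std_normal_density (0 + t * u)) * indicator A ((0 + t * u) / t) \<partial>lborel)"
    using t by (intro nn_integral_real_affine) auto
  also have "\<dots> = (\<integral>\<^sup>+u. ennreal (std_normal_density u) * (ennreal (t * exp ((1 - t\<^sup>2) / 2 * u\<^sup>2)) * indicator A u) \<partial>lborel)"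
  proof (subst nn_integral_cmult[symmetric])
    show "(\<integral>\<^sup>+u. ennreal \<bar>t\<bar> * (ennreal (std_normal_density (0 + t * u)) * indicator A ((0 + t * u) / t)) \<partial>lborel)
      = (\<integral>\<^sup>+u. ennreal (std_normal_density u) * (ennreal (t * exp ((1 - t\<^sup>2) / 2 * u\<^sup>2)) * indicator A u) \<partial>lborel)"
      using t by (intro nn_integral_cong) (simp add: d ennreal_mult', simp add: mult_ac)
  qed measurable
  also have "\<dots> = emeasure (density std_normal (\<lambda>u. ennreal (t * exp ((1 - t\<^sup>2) / 2 * u\<^sup>2)))) A"
    by (simp add: emeasure_density nn_integral_density)
  finally show "emeasure (distr std_normal std_normal (\<lambda>x. x / t)) A =
     emeasure (density std_normal (\<lambda>u. ennreal (t * exp ((1 - t\<^sup>2) / 2 * u\<^sup>2)))) A" .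
qed simp

text \<open>Dilates are tested by preimages: \<open>shrink n t x \<in> K\<close> says that
  \<open>x\<close> lies in the dilate of \<open>K\<close> by \<open>t\<close>.\<close>

definition shrink :: "nat \<Rightarrow> real \<Rightarrow> (nat \<Rightarrow> real) \<Rightarrow> nat \<Rightarrow> real" where
  "shrink n t x = (\<lambda>i\<in>{..<n}. x i / t)"

lemma measurable_shrink [measurable]:
  assumes [measurable]: "f \<in> M \<rightarrow>\<^sub>M gauss n"
  shows "(\<lambda>w. shrink n t (f w)) \<in> M \<rightarrow>\<^sub>M gauss n"
  unfolding shrink_def measurable_cong_sets[OF refl sets_gauss]
  using measurable_gauss_component[OF assms] by measurable

text \<open>With t^2 = 1 - 2 \<tau> the exponential is exp (\<tau> |x|^2). This is the link between
  Gaussian volumes of dilates and exponential moments of the squared norm.\<close>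

lemma distr_gauss_shrink:
  assumes t: "t > 0"
  shows "distr (gauss n) (gauss n) (shrink n t) =
    density (gauss n) (\<lambda>x. ennreal (t ^ n * exp ((1 - t\<^sup>2) / 2 * (\<Sum>i<n. (x i)\<^sup>2))))"
proof -
  have s: "shrink n t = compose {..<n} (\<lambda>x. x / t)"
    by (auto simp: shrink_def compose_def fun_eq_iff)
  have p: "prob_space (density std_normal (\<lambda>u. ennreal (t * exp ((1 - t\<^sup>2) / 2 * u\<^sup>2))))"
    by (subst distr_std_normal_shrink[OF t, symmetric])
      (intro prob_space.prob_space_distr prob_space_std_normal, simp)
  have "distr (gauss n) (gauss n) (shrink n t) = PiM {..<n} (\<lambda>_. distr std_normal std_normal (\<lambda>x. x / t))"
    unfolding s gauss_def by (intro distr_PiM_finite_prob_space' prob_space_std_normal) auto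
  also have "\<dots> = density (gauss n) (\<lambda>x. \<Prod>i<n. ennreal (t * exp ((1 - t\<^sup>2) / 2 * (x i)\<^sup>2)))"
    unfolding distr_std_normal_shrink[OF t] gauss_def
    by (intro PiM_density prob_space_imp_sigma_finite prob_space_std_normal p) auto
  also have "(\<lambda>x. \<Prod>i<n. ennreal (t * exp ((1 - t\<^sup>2) / 2 * (x i)\<^sup>2)))
     = (\<lambda>x. ennreal (t ^ n * exp ((1 - t\<^sup>2) / 2 * (\<Sum>i<n. (x i)\<^sup>2))))"
    using t by (auto simp: fun_eq_iff prod_ennreal prod.distrib exp_sum sum_distrib_left)
  finally show ?thesis .
qed

lemma distributed_dotp_gauss:
  assumes a: "dotp n a a = 1"
  shows "distributed (gauss n) lborel (dotp n a) std_normal_density"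
proof -
  interpret prob_space "gauss n" by (rule prob_space_gauss)
  \<comment> \<open>Zero coefficients are dropped, since the rule for sums of independent normals
    asks for positive standard deviations.\<close>
  define J where "J = {i. i < n \<and> a i \<noteq> 0}"
  have J: "finite J" "J \<subseteq> {..<n}" by (auto simp: J_def)
  have sumJ: "(\<Sum>i<n. a i * x i) = (\<Sum>i\<in>J. a i * x i)" for x :: "nat \<Rightarrow> real"
    using J by (intro sum.mono_neutral_right) (auto simp: J_def)
  have "J \<noteq> {}"
  proof
    assume "J = {}"
    then have "dotp n a a = 0" using sumJ[of a] by (simp add: dotp_def)
    with a show False by simp
  qed
  have comp: "distr (gauss n) std_normal (\<lambda>x. x i) = std_normal" if "i < n" for i
    using that unfolding gauss_def by (intro distr_PiM_component prob_space_std_normal) auto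
  have ne: "{..<n} \<noteq> {}" using J \<open>J \<noteq> {}\<close> by blast
  have [measurable]: "(\<lambda>x. x i) \<in> gauss n \<rightarrow>\<^sub>M std_normal" if "i < n" for i
    using that unfolding gauss_def by (intro measurable_component_singleton) simp
  have "indep_vars (\<lambda>_. std_normal) (\<lambda>i x. x i) {..<n}"
  proof (subst indep_vars_iff_distr_eq_PiM'[OF ne])
    have "distr (gauss n) (PiM {..<n} (\<lambda>_. std_normal)) (\<lambda>x. \<lambda>i\<in>{..<n}. x i) = distr (gauss n) (gauss n) (\<lambda>x. x)"
      by (intro distr_cong) (auto simp: gauss_def space_PiM PiE_def extensional_restrict)
    also have "\<dots> = PiM {..<n} (\<lambda>_. std_normal)" by (simp add: distr_id gauss_def)
    also have "\<dots> = PiM {..<n} (\<lambda>i. distr (gauss n) std_normal (\<lambda>x. x i))"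
      using comp by (intro PiM_cong) auto
    finally show "distr (gauss n) (PiM {..<n} (\<lambda>_. std_normal)) (\<lambda>x. \<lambda>i\<in>{..<n}. x i) =
      PiM {..<n} (\<lambda>i. distr (gauss n) std_normal (\<lambda>x. x i))" .
  qed auto
  then have "indep_vars (\<lambda>_. std_normal) (\<lambda>i x. x i) J"
    using J(2) by (rule indep_vars_subset)
  then have ind: "indep_vars (\<lambda>_. borel) (\<lambda>i x. a i * x i) J"
    by (rule indep_vars_compose2) auto
  have dist: "distributed (gauss n) lborel (\<lambda>x. a i * x i) (normal_density 0 \<bar>a i\<bar>)" if i: "i \<in> J" for i
  proof -
    have "distr (gauss n) lborel (\<lambda>x. x i) = distr (gauss n) std_normal (\<lambda>x. x i)"
      by (intro distr_cong) auto
    then have "distributed (gauss n) lborel (\<lambda>x. x i) std_normal_density"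
      using comp[of i] i unfolding distributed_def by (auto simp: J_def measurable_lborel1)
    from normal_density_affine[OF this, of "a i" 0] show ?thesis
      using i by (simp add: J_def)
  qed
  have "distributed (gauss n) lborel (\<lambda>x. \<Sum>i\<in>J. a i * x i) (normal_density (\<Sum>i\<in>J. 0) (sqrt (\<Sum>i\<in>J. \<bar>a i\<bar>\<^sup>2)))"
    by (intro sum_indep_normal J \<open>J \<noteq> {}\<close> ind dist) (auto simp: J_def)
  moreover have "(\<Sum>i\<in>J. \<bar>a i\<bar>\<^sup>2) = 1"
    using a sumJ[of a] by (simp add: dotp_def power2_eq_square)
  moreover have "(\<lambda>x. \<Sum>i\<in>J. a i * x i) = dotp n a"
    by (simp add: fun_eq_iff dotp_def sumJ)
  ultimately show ?thesis by simp
qed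

lemma nn_integral_dotp_square:
  assumes a: "dotp n a a = 1"
  shows "(\<integral>\<^sup>+x. ennreal ((dotp n a x)\<^sup>2) \<partial>gauss n) = 1"
proof -
  have "(\<integral>\<^sup>+x. ennreal ((dotp n a x)\<^sup>2) \<partial>gauss n) = (\<integral>\<^sup>+u. ennreal (std_normal_density u) * ennreal (u\<^sup>2) \<partial>lborel)"
    by (rule distributed_nn_integral[OF distributed_dotp_gauss[OF a], symmetric]) simp
  also have "\<dots> = (\<integral>\<^sup>+u. ennreal (std_normal_density u * u ^ (2 * 1)) \<partial>lborel)"
    by (simp add: ennreal_mult')
  also have "\<dots> = ennreal (fact (2 * 1) / (2 ^ 1 * fact 1))"
    using std_normal_moment_even[of 1]
    by (intro nn_integral_eq_integral[THEN trans] arg_cong[of _ _ ennreal])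
      (auto simp: has_bochner_integral_iff)
  finally show ?thesis by simp
qed

text \<open>\<open>dotp n a\<close> is standard normal with density at most 1/2, and the slab is an
  interval of length \<open>2 * w / d\<close> for it.\<close>

lemma gauss_slab_le:
  assumes a: "dotp n a a = 1" and w: "0 \<le> w" and d: "d > 0"
  shows "emeasure (gauss n) {y\<in>space (gauss n). \<bar>c + d * dotp n a y\<bar> \<le> w} \<le> ennreal (w / d)"
proof -
  have eq: "{y\<in>space (gauss n). \<bar>c + d * dotp n a y\<bar> \<le> w} = dotp n a -` {(- w - c) / d..(w - c) / d} \<inter> space (gauss n)"
    using d by (auto simp: field_simps abs_le_iff)
  have "emeasure (gauss n) {y\<in>space (gauss n). \<bar>c + d * dotp n a y\<bar> \<le> w}
      = (\<integral>\<^sup>+u. ennreal (std_normal_density u) * indicator {(- w - c) / d..(w - c) / d} u \<partial>lborel)"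
    unfolding eq by (rule distributed_emeasure[OF distributed_dotp_gauss[OF a]]) simp
  also have "\<dots> \<le> (\<integral>\<^sup>+u. ennreal (1 / 2) * indicator {(- w - c) / d..(w - c) / d} u \<partial>lborel)"
  proof (intro nn_integral_mono mult_right_mono ennreal_leI)
    fix u :: real
    have "2 \<le> sqrt (2 * pi)" using pi_gt3 by (intro real_le_rsqrt) simp
    then have "1 / sqrt (2 * pi) \<le> 1 / 2" by (intro divide_left_mono) auto
    moreover have "exp (- u\<^sup>2 / 2) \<le> 1" by simp
    ultimately have "(1 / sqrt (2 * pi)) * exp (- u\<^sup>2 / 2) \<le> 1 / 2 * 1"
      by (intro mult_mono) auto
    then show "std_normal_density u \<le> 1 / 2" by (simp add: std_normal_density_def)
  qed auto
  also have "\<dots> = ennreal (1 / 2) * ennreal ((w - c) / d - (- w - c) / d)"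
    using w d by (subst nn_integral_cmult_indicator) (auto simp: divide_right_mono)
  also have "\<dots> = ennreal (w / d)"
    using w d by (subst ennreal_mult'[symmetric]) (auto simp: field_simps)
  finally show ?thesis .
qed

text \<open>From |u| \<le> (1 + u^2) / 2 and the second moment 1.\<close>

lemma nn_integral_abs_dotp_le:
  assumes a: "dotp n a a = 1"
  shows "(\<integral>\<^sup>+y. ennreal \<bar>dotp n a y\<bar> \<partial>gauss n) \<le> 1"
proof -
  have "(\<integral>\<^sup>+y. ennreal \<bar>dotp n a y\<bar> \<partial>gauss n) \<le> (\<integral>\<^sup>+y. ennreal (1/2) * (1 + ennreal ((dotp n a y)\<^sup>2)) \<partial>gauss n)"
  proof (rule nn_integral_mono)
    fix y
    have "\<bar>u\<bar> \<le> 1/2 * (1 + u\<^sup>2)" for u :: real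
      using sum_squares_bound[of "\<bar>u\<bar>" 1] by simp
    then have "ennreal \<bar>dotp n a y\<bar> \<le> ennreal (1/2 * (1 + (dotp n a y)\<^sup>2))" by (rule ennreal_leI)
    also have "\<dots> = ennreal (1/2) * (1 + ennreal ((dotp n a y)\<^sup>2))"
      by (subst ennreal_mult') (auto simp del: ennreal_half)
    finally show "ennreal \<bar>dotp n a y\<bar> \<le> ennreal (1/2) * (1 + ennreal ((dotp n a y)\<^sup>2))" .
  qed
  also have "\<dots> = ennreal (1/2) * (1 + 1)"
    by (simp add: nn_integral_cmult nn_integral_add nn_integral_dotp_square[OF a] prob_space.emeasure_space_1[OF prob_space_gauss])
  also have "\<dots> = ennreal (1/2 * 2)"
    by (subst ennreal_mult') auto
  finally show ?thesis by simp
qed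

section \<open>Gaussian measure of dilates\<close>

lemma one_minus_cos_le: "1 - cos x \<le> x\<^sup>2 / 2" for x :: real
proof -
  have "1 - cos x = 2 * (sin (x / 2))\<^sup>2"
    using cos_double_sin[of "x / 2"] by simp
  also have "(sin (x / 2))\<^sup>2 \<le> (x / 2)\<^sup>2"
    using abs_sin_x_le_abs_x[of "x / 2"] by (simp only: abs_le_square_iff)
  finally show ?thesis by (simp add: power_divide)
qed

lemma sin_ge_half: "0 \<le> x \<Longrightarrow> x \<le> 1 / 2 \<Longrightarrow> x / 2 \<le> sin x" for x :: real
proof (cases "x = 0")
  case False
  assume x: "0 \<le> x" "x \<le> 1 / 2"
  with False have "0 < x" by simp
  then obtain z where z: "0 < z" "z < x" "sin x - sin 0 = (x - 0) * cos z"
    using MVT2[of 0 x sin cos] by auto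
  have "cos (pi / 3) \<le> cos z" using x z pi_gt3 by (intro cos_monotone_0_pi_le) auto
  then have "1 / 2 \<le> cos z" by (simp add: cos_60)
  then have "x * (1 / 2) \<le> x * cos z" using x by (intro mult_left_mono) auto
  with z show ?thesis by simp
qed simp

text \<open>The coercion cuts negative values to 0, so it is only subadditive. It serves to bound
  the positive part of a telescoping sum by the positive parts of the increments.\<close>

lemma ennreal_sum_le: "finite I \<Longrightarrow> ennreal (\<Sum>i\<in>I. f i) \<le> (\<Sum>i\<in>I. ennreal (f i))"
proof (induction I rule: finite_induct)
  case (insert i I)
  have "ennreal (f i + sum f I) \<le> ennreal (f i) + ennreal (sum f I)"
    by (cases "0 \<le> f i"; cases "0 \<le> sum f I")
      (auto simp: ennreal_plus ennreal_neg intro!: ennreal_leI)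
  also have "\<dots> \<le> ennreal (f i) + (\<Sum>i\<in>I. ennreal (f i))"
    using insert.IH by (rule add_left_mono)
  finally show ?case using insert by simp
qed simp

text \<open>The law of the rescaled vector has a density with respect to \<open>gauss n\<close>, so
  null sets are preserved.\<close>

lemma AE_gauss_shrink:
  assumes P: "AE x in gauss n. P x" and t: "t > 0"
  shows "AE x in gauss n. P (shrink n t x)"
proof -
  have "AE x in distr (gauss n) (gauss n) (shrink n t). P x"
    unfolding distr_gauss_shrink[OF t] using P by (subst AE_density) auto
  then show ?thesis by (rule AE_distrD[rotated]) simp
qed

text \<open>For \<open>s < 1\<close> this is 0 up to \<open>s\<close>, 1 from 1 on, and linear with
  slope \<open>1 / (1 - s)\<close> in between.\<close>

definition cutoff :: "real \<Rightarrow> real \<Rightarrow> real" where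
  "cutoff s q = max 0 (min 1 ((q - s) / (1 - s)))"

lemma cutoff_bounds: "0 \<le> cutoff s q" "cutoff s q \<le> 1"
  by (auto simp: cutoff_def)

lemma cutoff_mono: "s < 1 \<Longrightarrow> p \<le> q \<Longrightarrow> cutoff s p \<le> cutoff s q"
  unfolding cutoff_def by (intro max.mono min.mono divide_right_mono order_refl) auto

lemma cutoff_lipschitz:
  assumes "s < 1" "p \<le> q" shows "cutoff s q \<le> cutoff s p + (q - p) / (1 - s)"
proof -
  have "(q - s) / (1 - s) = (p - s) / (1 - s) + (q - p) / (1 - s)"
    by (simp add: add_divide_distrib[symmetric])
  moreover have "0 \<le> (q - p) / (1 - s)" using assms by simp
  ultimately show ?thesis by (auto simp: cutoff_def max_def min_def)
qed

lemma cutoff_eq_1: "s < 1 \<Longrightarrow> 1 \<le> q \<Longrightarrow> cutoff s q = 1"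
  by (auto simp: cutoff_def max_def min_def field_simps)

lemma cutoff_ge: "s < 1 \<Longrightarrow> q \<le> 1 \<Longrightarrow> (q - s) / (1 - s) \<le> cutoff s q"
  by (auto simp: cutoff_def max_def min_def field_simps)

text \<open>\<open>A\<close> is a Borel version of \<open>K\<close>, which is only Lebesgue measurable.\<close>

locale symm_convex_body =
  fixes n :: nat and K A :: "(nat \<Rightarrow> real) set"
  assumes n: "n > 0"
    and convex: "convex_fun_set K"
    and symm: "x \<in> K \<Longrightarrow> (\<lambda>i. - x i) \<in> K"
    and coords: "(\<And>i. i < n \<Longrightarrow> x i = y i) \<Longrightarrow> x \<in> K \<Longrightarrow> y \<in> K"
    and A [measurable]: "A \<in> sets (gauss n)"
    and AE_A: "AE x in gauss n. x \<in> A \<longleftrightarrow> x \<in> K"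
    and A_pos: "measure (gauss n) A > 0"
begin

sublocale \<Gamma>: prob_space "gauss n"
  by (rule prob_space_gauss)

sublocale \<Gamma>\<Gamma>: pair_prob_space "gauss n" "gauss n"
  ..

definition G :: "real \<Rightarrow> real" where
  "G t = measure (gauss n) {x \<in> space (gauss n). shrink n t x \<in> A}"

text \<open>\<open>wide r\<close> holds iff the closure of \<open>K\<close> contains the ball of radius \<open>r\<close>.\<close>

definition wide :: "real \<Rightarrow> bool" where
  "wide r \<longleftrightarrow> (\<forall>a h. dotp n a a = 1 \<longrightarrow> (\<forall>k\<in>K. dotp n a k \<le> h) \<longrightarrow> r \<le> h)"

lemma shrink_mem_iff: "shrink n t x \<in> K \<longleftrightarrow> (\<lambda>i. x i / t) \<in> K"
  using coords[of "shrink n t x" "\<lambda>i. x i / t"] coords[of "\<lambda>i. x i / t" "shrink n t x"]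
  by (auto simp: shrink_def)

lemma zero_mem: assumes "x \<in> K" shows "(\<lambda>_. 0) \<in> K"
  using convex_fun_setD[OF convex assms symm[OF assms], of "1/2" "1/2"] by simp

text \<open>\<open>K\<close> is star-shaped about the origin: x / u is a convex combination of x / t
  and 0.\<close>

lemma shrink_mem_mono:
  assumes "0 < t" "t \<le> u" "shrink n t x \<in> K" shows "shrink n u x \<in> K"
proof -
  have x: "(\<lambda>i. x i / t) \<in> K" using assms by (simp add: shrink_mem_iff)
  have "(\<lambda>i. (t / u) * (x i / t) + (1 - t / u) * 0) \<in> K"
    using assms by (intro convex_fun_setD[OF convex x zero_mem[OF x]]) auto
  then show ?thesis using assms by (simp add: shrink_mem_iff)
qed

lemma shrink_1_mem_iff: "shrink n 1 x \<in> K \<longleftrightarrow> x \<in> K"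
  by (simp add: shrink_mem_iff)

lemma AE_shrink_A: "t > 0 \<Longrightarrow> AE x in gauss n. shrink n t x \<in> A \<longleftrightarrow> shrink n t x \<in> K"
  by (rule AE_gauss_shrink[OF AE_A])

lemma G_1: "G 1 = measure (gauss n) A"
proof -
  have "shrink n 1 x = x" if "x \<in> space (gauss n)" for x
    using that by (auto simp: shrink_def space_gauss PiE_def extensional_def)
  then have "{x \<in> space (gauss n). shrink n 1 x \<in> A} = A"
    using sets.sets_into_space[OF A] by auto
  then show ?thesis by (simp add: G_def)
qed

lemma emeasure_G:
  assumes t: "t > 0"
  shows "ennreal (G t) = (\<integral>\<^sup>+x. ennreal (t ^ n * exp ((1 - t\<^sup>2) / 2 * (\<Sum>i<n. (x i)\<^sup>2))) * indicator A x \<partial>gauss n)"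
proof -
  have "ennreal (G t) = emeasure (distr (gauss n) (gauss n) (shrink n t)) A"
    unfolding G_def \<Gamma>.emeasure_eq_measure[symmetric]
    by (subst emeasure_distr) (auto intro!: arg_cong[where f="emeasure _"])
  also have "\<dots> = (\<integral>\<^sup>+x. ennreal (t ^ n * exp ((1 - t\<^sup>2) / 2 * (\<Sum>i<n. (x i)\<^sup>2))) * indicator A x \<partial>gauss n)"
    unfolding distr_gauss_shrink[OF t] by (subst emeasure_density) auto
  finally show ?thesis .
qed

text \<open>For \<open>t \<ge> 1\<close> the exponential in \<open>emeasure_G\<close> is at most 1.
  This bounds \<open>G (1 + \<eta>)\<close> by a quantity that tends to \<open>G 1\<close> as
  \<open>\<eta>\<close> tends to 0.\<close>

lemma G_le:
  assumes t: "t \<ge> 1" shows "G t \<le> t ^ n * G 1"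
proof -
  have "ennreal (G t) \<le> (\<integral>\<^sup>+x. ennreal (t ^ n) * indicator A x \<partial>gauss n)"
    unfolding emeasure_G[OF less_le_trans[OF zero_less_one t]]
  proof (intro nn_integral_mono mult_right_mono ennreal_leI)
    fix x :: "nat \<Rightarrow> real"
    have "1 \<le> t\<^sup>2" using t by (rule one_le_power)
    then have "(1 - t\<^sup>2) / 2 * (\<Sum>i<n. (x i)\<^sup>2) \<le> 0"
      by (intro mult_nonpos_nonneg sum_nonneg) auto
    then have "exp ((1 - t\<^sup>2) / 2 * (\<Sum>i<n. (x i)\<^sup>2)) \<le> 1" by simp
    then have "t ^ n * exp ((1 - t\<^sup>2) / 2 * (\<Sum>i<n. (x i)\<^sup>2)) \<le> t ^ n * 1"
      using t by (intro mult_left_mono) auto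
    then show "t ^ n * exp ((1 - t\<^sup>2) / 2 * (\<Sum>i<n. (x i)\<^sup>2)) \<le> t ^ n" by simp
  qed auto
  also have "\<dots> = ennreal (t ^ n * G 1)"
    using t by (subst nn_integral_cmult_indicator) (auto simp: G_1 \<Gamma>.emeasure_eq_measure ennreal_mult')
  finally show ?thesis
    using t by (subst (asm) ennreal_le_iff) (auto simp: G_def)
qed

section \<open>The cut-off gauge of the body\<close>

definition good :: "(nat \<Rightarrow> real) \<Rightarrow> bool" where
  "good x \<longleftrightarrow> (x \<in> A \<longleftrightarrow> x \<in> K) \<and> (\<forall>q\<in>{q\<in>\<rat>. 0 < q}. shrink n q x \<in> A \<longleftrightarrow> shrink n q x \<in> K)"

text \<open>Only countably many dilations are involved, and each of them preserves null
  sets.\<close>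

lemma AE_good: "AE x in gauss n. good x"
proof -
  have "countable {q \<in> \<rat>. 0 < (q::real)}" using countable_rat by (rule countable_subset[rotated]) auto
  then have "AE x in gauss n. \<forall>q\<in>{q\<in>\<rat>. 0 < (q::real)}. shrink n q x \<in> A \<longleftrightarrow> shrink n q x \<in> K"
    by (subst AE_ball_countable) (auto intro: AE_shrink_A)
  with AE_A show ?thesis by eventually_elim (simp add: good_def)
qed

text \<open>On good points this is \<open>cutoff s\<close> applied to the Minkowski gauge of \<open>K\<close>. Ranging over rational
  dilates of the Borel set \<open>A\<close> keeps it Borel measurable.\<close>

definition ramp :: "real \<Rightarrow> (nat \<Rightarrow> real) \<Rightarrow> real" where
  "ramp s x = (INF q\<in>{q\<in>\<rat>. 0 < q}. if shrink n q x \<in> A then cutoff s q else 1)"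

lemma pos_rat_nonempty: "{q\<in>\<rat>. 0 < (q::real)} \<noteq> {}"
  using Rats_1 zero_less_one by blast

lemma ramp_bdd: "bdd_below ((\<lambda>q. if shrink n q x \<in> A then cutoff s q else 1) ` Q)"
  by (rule bdd_belowI[of _ 0]) (auto simp: cutoff_bounds)

lemma measurable_ramp [measurable]: "ramp s \<in> borel_measurable (gauss n)"
  unfolding ramp_def
  by (intro borel_measurable_cINF ramp_bdd) (auto intro: countable_subset[OF _ countable_rat])

lemma ramp_bounds: "0 \<le> ramp s x" "ramp s x \<le> 1"
proof -
  show "0 \<le> ramp s x"
    unfolding ramp_def by (intro cINF_greatest pos_rat_nonempty) (auto simp: cutoff_bounds)
  have "ramp s x \<le> (if shrink n 1 x \<in> A then cutoff s 1 else 1)"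
    unfolding ramp_def by (intro cINF_lower ramp_bdd) auto
  also have "\<dots> \<le> 1" by (auto simp: cutoff_bounds)
  finally show "ramp s x \<le> 1" .
qed

text \<open>A rational dilate slightly larger than \<open>t\<close> still contains \<open>x\<close>,
  and the Lipschitz bound for \<open>cutoff\<close> absorbs the difference.\<close>

lemma ramp_le:
  assumes x: "good x" "shrink n t x \<in> K" and t: "t > 0" and s: "s < 1"
  shows "ramp s x \<le> cutoff s t"
proof (rule field_le_epsilon)
  fix e :: real assume e: "e > 0"
  have "t < t + e * (1 - s)" using e s by simp
  then obtain q where q: "q \<in> \<rat>" "t < q" "q < t + e * (1 - s)"
    using Rats_dense_in_real by blast
  have "shrink n q x \<in> K" using x t q by (intro shrink_mem_mono[of t q]) auto
  then have "shrink n q x \<in> A" using x t q by (auto simp: good_def)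
  then have "ramp s x \<le> cutoff s q"
    unfolding ramp_def using q t by (intro cINF_lower2[OF ramp_bdd, of q]) auto
  also have "\<dots> \<le> cutoff s t + (q - t) / (1 - s)" using q s by (intro cutoff_lipschitz) auto
  also have "(q - t) / (1 - s) \<le> e" using q s by (simp add: field_simps)
  finally show "ramp s x \<le> cutoff s t + e" by simp
qed

text \<open>If \<open>x\<close> lies in the dilate by \<open>q\<close>, then
  \<open>dotp n a x \<le> q * h\<close>. So a halfspace containing \<open>K\<close> bounds the gauge
  from below.\<close>

lemma ramp_ge:
  assumes x: "good x" and a: "\<And>k. k \<in> K \<Longrightarrow> dotp n a k \<le> h" and h: "h > 0" and s: "s < 1"
  shows "cutoff s (dotp n a x / h) \<le> ramp s x"
  unfolding ramp_def
proof (intro cINF_greatest pos_rat_nonempty)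
  fix q :: real assume q: "q \<in> {q \<in> \<rat>. 0 < q}"
  show "cutoff s (dotp n a x / h) \<le> (if shrink n q x \<in> A then cutoff s q else 1)"
  proof (cases "shrink n q x \<in> A")
    case True
    then have "(\<lambda>i. 1 / q * x i) \<in> K" using x q by (auto simp: good_def shrink_mem_iff)
    from a[OF this] have "dotp n a x / q \<le> h" by (subst (asm) dotp_scale_right) simp
    then have "dotp n a x / h \<le> q" using q h by (simp add: field_simps)
    then show ?thesis using True s by (simp add: cutoff_mono)
  qed (simp add: cutoff_bounds)
qed

lemma ramp_outside:
  assumes x: "good x" "x \<notin> K" and s: "s < 1"
  shows "ramp s x = 1"
proof (rule antisym[OF ramp_bounds(2)])
  show "1 \<le> ramp s x"
    unfolding ramp_def
  proof (intro cINF_greatest pos_rat_nonempty)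
    fix q :: real assume q: "q \<in> {q \<in> \<rat>. 0 < q}"
    have "1 \<le> q" if "shrink n q x \<in> A"
    proof (rule ccontr)
      assume "\<not> 1 \<le> q"
      with that x q have "shrink n 1 x \<in> K" by (intro shrink_mem_mono[of q 1]) (auto simp: good_def)
      with x show False by (simp add: shrink_1_mem_iff)
    qed
    then show "1 \<le> (if shrink n q x \<in> A then cutoff s q else 1)" using s by (simp add: cutoff_eq_1)
  qed
qed

lemma ramp_inside:
  assumes x: "good x" "shrink n s x \<in> K" and s: "0 < s" "s < 1"
  shows "ramp s x = 0"
  using ramp_le[OF x s] ramp_bounds(1)[of s x] by (simp add: cutoff_def)

section \<open>Change of the gauge along a short arc\<close>

lemma separate_shrink:
  assumes r: "wide r" "0 < r" and t: "0 < t" and x: "shrink n t x \<notin> K"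
  obtains a h where "dotp n a a = 1" "r \<le> h" "\<And>k. k \<in> K \<Longrightarrow> dotp n a k \<le> h" "dotp n a x = t * h"
proof -
  let ?y = "\<lambda>i. 1 / t * x i"
  have "?y \<notin> K" using x by (simp add: shrink_mem_iff)
  then have "\<And>y. y \<in> K \<Longrightarrow> \<exists>i<n. y i \<noteq> ?y i" using coords by metis
  \<comment> \<open>The hyperplane passes through x / t itself, so with
    \<open>h = dotp n a ?y\<close> the value \<open>dotp n a x\<close> is known exactly.\<close>
  from weak_separation[OF convex this n] obtain a
    where a: "dotp n a a = 1" "\<And>k. k \<in> K \<Longrightarrow> dotp n a k \<le> dotp n a ?y" by blast
  show ?thesis
  proof
    show "dotp n a x = t * dotp n a ?y" using t by (subst dotp_scale_right) simp
    show "r \<le> dotp n a ?y" using r a unfolding wide_def by blast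
  qed (use a in auto)
qed

text \<open>A halfspace containing \<open>K\<close> whose dilate by \<open>t\<close> has
  \<open>x\<close> on its boundary bounds the new gauge from below. The loss is at most
  \<open>1 - cos \<delta>\<close> from contracting \<open>x\<close>, plus
  \<open>\<bar>sin \<delta>\<bar> * \<bar>dotp n a y\<bar> / r\<close> from the Gaussian increment,
  whose mean absolute value is at most 1.\<close>

lemma ramp_step_near:
  assumes r: "wide r" "0 < r" and s: "0 < s" "s < 1"
    and x: "good x" and y: "AE y in gauss n. good (arc n \<delta> x y)"
  shows "(\<integral>\<^sup>+y. ennreal (ramp s x - ramp s (arc n \<delta> x y)) \<partial>gauss n)
    \<le> ennreal (((1 - cos \<delta>) + \<bar>sin \<delta>\<bar> / r) / (1 - s))"
proof (rule ennreal_le_epsilon)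
  fix e :: real assume e: "e > 0"
  \<comment> \<open>A value just below \<open>ramp s x\<close>, with \<open>cutoff s t = v\<close>.
    Then \<open>x\<close> is outside the dilate by \<open>t\<close> and can be separated from it,
    whereas at its own gauge it may belong to the dilate. The loss \<open>e\<close> is
    arbitrary.\<close>
  define v where "v = max 0 (ramp s x - e)"
  define t where "t = s + (1 - s) * v"
  have B0: "0 \<le> ((1 - cos \<delta>) + \<bar>sin \<delta>\<bar> / r) / (1 - s)"
    using r s by (intro divide_nonneg_pos add_nonneg_nonneg) auto
  show "(\<integral>\<^sup>+y. ennreal (ramp s x - ramp s (arc n \<delta> x y)) \<partial>gauss n)
    \<le> ennreal (((1 - cos \<delta>) + \<bar>sin \<delta>\<bar> / r) / (1 - s)) + ennreal e"
  proof (cases "ramp s x = 0")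
    case True
    then have "ennreal (ramp s x - ramp s (arc n \<delta> x y)) = 0" for y
      using ramp_bounds(1)[of s "arc n \<delta> x y"] by (simp add: ennreal_neg)
    then show ?thesis by simp
  next
    case False
    then have v: "0 \<le> v" "v < ramp s x" "ramp s x \<le> v + e"
      using e ramp_bounds(1)[of s x] by (auto simp: v_def)
    then have "v < 1" using ramp_bounds(2)[of s x] by simp
    then have "t \<le> s + (1 - s) * 1" unfolding t_def using s by (intro add_left_mono mult_left_mono) auto
    then have t: "t \<le> 1" "0 < t" using v s by (auto simp: t_def add_pos_nonneg)
    have "cutoff s t = v" using v \<open>v < 1\<close> s by (simp add: cutoff_def t_def)
    then have "shrink n t x \<notin> K"
      using ramp_le[OF x _ t(2) s(2)] v by auto
    from separate_shrink[OF r t(2) this] obtain a h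
      where a: "dotp n a a = 1" "r \<le> h" "\<And>k. k \<in> K \<Longrightarrow> dotp n a k \<le> h" "dotp n a x = t * h"
      by metis
    have h: "h > 0" using a r by simp
    let ?B = "\<lambda>y. ((1 - cos \<delta>) + \<bar>sin \<delta>\<bar> * \<bar>dotp n a y\<bar> / r) / (1 - s)"
    have bound: "ramp s x - ramp s (arc n \<delta> x y) \<le> e + ?B y" if gy: "good (arc n \<delta> x y)" for y
    proof -
      define p where "p = dotp n a (arc n \<delta> x y) / h"
      have p: "p = cos \<delta> * t + sin \<delta> * dotp n a y / h"
        using h by (simp add: p_def dotp_arc a(4) add_divide_distrib)
      have ge: "cutoff s p \<le> ramp s (arc n \<delta> x y)"
        unfolding p_def by (rule ramp_ge[OF gy a(3) h s(2)])
      have B: "0 \<le> ?B y" using r s by (intro divide_nonneg_pos add_nonneg_nonneg) auto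
      show ?thesis
      \<comment> \<open>If \<open>1 \<le> p\<close>, the ramp at the endpoint has its largest value
        1 and nothing is lost.\<close>
      proof (cases "1 \<le> p")
        case True
        then show ?thesis using ge cutoff_eq_1[OF s(2) True] ramp_bounds(2)[of s x] e B by simp
      next
        case False
        have "ramp s x - ramp s (arc n \<delta> x y) \<le> v + e - (p - s) / (1 - s)"
          using ge cutoff_ge[OF s(2), of p] False v by simp
        also have "\<dots> = e + (t - p) / (1 - s)"
          using s by (simp add: t_def field_simps)
        also have "t - p \<le> (1 - cos \<delta>) + \<bar>sin \<delta>\<bar> * \<bar>dotp n a y\<bar> / r"
        proof -
          have "t - p = (1 - cos \<delta>) * t + - (sin \<delta> * dotp n a y / h)"
            unfolding p by (simp add: algebra_simps)
          also have "- (sin \<delta> * dotp n a y / h) \<le> \<bar>sin \<delta> * dotp n a y / h\<bar>" by (rule abs_ge_minus_self)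
          also have "\<dots> = \<bar>sin \<delta>\<bar> * \<bar>dotp n a y\<bar> / h" using h by (simp add: abs_mult)
          also have "\<dots> \<le> \<bar>sin \<delta>\<bar> * \<bar>dotp n a y\<bar> / r" using a r h by (intro divide_left_mono) auto
          also have "(1 - cos \<delta>) * t \<le> (1 - cos \<delta>) * 1" using t by (intro mult_left_mono) auto
          finally show ?thesis by simp
        qed
        finally show ?thesis using s by (simp add: divide_right_mono)
      qed
    qed
    have "(\<integral>\<^sup>+y. ennreal (ramp s x - ramp s (arc n \<delta> x y)) \<partial>gauss n)
        \<le> (\<integral>\<^sup>+y. ennreal (e + (1 - cos \<delta>) / (1 - s)) + ennreal (\<bar>sin \<delta>\<bar> / r / (1 - s)) * ennreal \<bar>dotp n a y\<bar> \<partial>gauss n)"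
    proof (rule nn_integral_mono_AE)
      from y show "AE y in gauss n. ennreal (ramp s x - ramp s (arc n \<delta> x y))
         \<le> ennreal (e + (1 - cos \<delta>) / (1 - s)) + ennreal (\<bar>sin \<delta>\<bar> / r / (1 - s)) * ennreal \<bar>dotp n a y\<bar>"
      proof eventually_elim
        case (elim y)
        have "ennreal (ramp s x - ramp s (arc n \<delta> x y)) \<le> ennreal ((e + (1 - cos \<delta>) / (1 - s)) + (\<bar>sin \<delta>\<bar> / r / (1 - s)) * \<bar>dotp n a y\<bar>)"
          using bound[OF elim] by (intro ennreal_leI) (simp add: add_divide_distrib mult_ac)
        also have "\<dots> = ennreal (e + (1 - cos \<delta>) / (1 - s)) + ennreal (\<bar>sin \<delta>\<bar> / r / (1 - s)) * ennreal \<bar>dotp n a y\<bar>"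
          using s r e by (subst ennreal_plus) (auto simp: ennreal_mult'[symmetric])
        finally show ?case .
      qed
    qed
    also have "\<dots> = ennreal (e + (1 - cos \<delta>) / (1 - s)) + ennreal (\<bar>sin \<delta>\<bar> / r / (1 - s)) * (\<integral>\<^sup>+y. ennreal \<bar>dotp n a y\<bar> \<partial>gauss n)"
      by (simp add: nn_integral_add nn_integral_cmult \<Gamma>.emeasure_space_1)
    also have "\<dots> \<le> ennreal (e + (1 - cos \<delta>) / (1 - s)) + ennreal (\<bar>sin \<delta>\<bar> / r / (1 - s)) * 1"
      by (intro add_left_mono mult_left_mono nn_integral_abs_dotp_le[OF a(1)]) auto
    also have "\<dots> = ennreal ((e + (1 - cos \<delta>) / (1 - s)) + \<bar>sin \<delta>\<bar> / r / (1 - s))"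
      using s r e by (subst ennreal_plus) auto
    also have "(e + (1 - cos \<delta>) / (1 - s)) + \<bar>sin \<delta>\<bar> / r / (1 - s) = ((1 - cos \<delta>) + \<bar>sin \<delta>\<bar> / r) / (1 - s) + e"
      by (simp add: add_divide_distrib)
    finally show ?thesis using B0 e by simp
  qed
qed

text \<open>From outside the dilate by \<open>1 + \<eta>\<close>, the ramp can fall only if the
  Gaussian increment in direction \<open>a\<close> compensates a margin of at least r (cos \<delta>
  (1 + \<eta>) - 1). Chebyshev's inequality gives a bound of order \<delta>^2, negligible even when
  summed over all steps.\<close>

lemma ramp_step_far:
  assumes r: "wide r" "0 < r" and s: "0 < s" "s < 1" and \<eta>: "0 < \<eta>"
    and \<beta>: "cos \<delta> * (1 + \<eta>) - 1 > 0"
    and x: "shrink n (1 + \<eta>) x \<notin> K" and y: "AE y in gauss n. good (arc n \<delta> x y)"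
  shows "(\<integral>\<^sup>+y. ennreal (ramp s x - ramp s (arc n \<delta> x y)) \<partial>gauss n)
    \<le> ennreal ((sin \<delta> / (r * (cos \<delta> * (1 + \<eta>) - 1)))\<^sup>2)"
proof -
  define \<beta> where "\<beta> = cos \<delta> * (1 + \<eta>) - 1"
  have \<beta>: "\<beta> > 0" using assms by (simp add: \<beta>_def)
  have "0 < 1 + \<eta>" using \<eta> by simp
  from separate_shrink[OF r this x] obtain a h
    where a: "dotp n a a = 1" "r \<le> h" "\<And>k. k \<in> K \<Longrightarrow> dotp n a k \<le> h" "dotp n a x = (1 + \<eta>) * h"
    by metis
  have h: "h > 0" using a r by simp
  have bound: "ramp s x - ramp s (arc n \<delta> x y) \<le> (sin \<delta> / (r * \<beta>))\<^sup>2 * (dotp n a y)\<^sup>2"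
    if gy: "good (arc n \<delta> x y)" for y
  proof -
    define p where "p = dotp n a (arc n \<delta> x y) / h"
    have p: "p = \<beta> + 1 + sin \<delta> * dotp n a y / h"
      using h by (simp add: p_def dotp_arc a(4) add_divide_distrib \<beta>_def)
    have ge: "cutoff s p \<le> ramp s (arc n \<delta> x y)"
      unfolding p_def by (rule ramp_ge[OF gy a(3) h s(2)])
    show ?thesis
    proof (cases "1 \<le> p")
      case True
      then have "ramp s x - ramp s (arc n \<delta> x y) \<le> 0"
        using ge cutoff_eq_1[OF s(2) True] ramp_bounds(2)[of s x] by simp
      also have "0 \<le> (sin \<delta> / (r * \<beta>))\<^sup>2 * (dotp n a y)\<^sup>2" by simp
      finally show ?thesis .
    next
      case False
      then have "\<beta> \<le> \<bar>sin \<delta> * dotp n a y / h\<bar>" unfolding p by linarith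
      also have "\<dots> = \<bar>sin \<delta> * dotp n a y\<bar> / h" using h by (simp add: abs_mult)
      also have "\<dots> \<le> \<bar>sin \<delta> * dotp n a y\<bar> / r" using a r h by (intro divide_left_mono) auto
      finally have "1 \<le> \<bar>sin \<delta> / (r * \<beta>) * dotp n a y\<bar>"
        using r \<beta> by (simp add: abs_mult field_simps)
      then have "1 \<le> (sin \<delta> / (r * \<beta>) * dotp n a y)\<^sup>2"
        by (metis one_le_power power2_abs)
      moreover have "ramp s x - ramp s (arc n \<delta> x y) \<le> 1"
        using ramp_bounds(2)[of s x] ramp_bounds(1)[of s "arc n \<delta> x y"] by simp
      ultimately show ?thesis unfolding power_mult_distrib[symmetric] by linarith
    qed
  qed
  have "(\<integral>\<^sup>+y. ennreal (ramp s x - ramp s (arc n \<delta> x y)) \<partial>gauss n)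
      \<le> (\<integral>\<^sup>+y. ennreal ((sin \<delta> / (r * \<beta>))\<^sup>2) * ennreal ((dotp n a y)\<^sup>2) \<partial>gauss n)"
  proof (rule nn_integral_mono_AE)
    from y show "AE y in gauss n. ennreal (ramp s x - ramp s (arc n \<delta> x y))
       \<le> ennreal ((sin \<delta> / (r * \<beta>))\<^sup>2) * ennreal ((dotp n a y)\<^sup>2)"
      by eventually_elim (auto simp: ennreal_mult'[symmetric] intro!: ennreal_leI bound)
  qed
  also have "\<dots> = ennreal ((sin \<delta> / (r * \<beta>))\<^sup>2)"
    by (simp add: nn_integral_cmult nn_integral_dotp_square[OF a(1)])
  finally show ?thesis by (simp add: \<beta>_def)
qed

abbreviation GG :: "((nat \<Rightarrow> real) \<times> (nat \<Rightarrow> real)) measure" where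
  "GG \<equiv> gauss n \<Otimes>\<^sub>M gauss n"

lemma AE_arc: "AE z in GG. good (arc n \<theta> (fst z) (snd z))"
proof -
  have "AE x in distr GG (gauss n) (\<lambda>z. arc n \<theta> (fst z) (snd z)). good x"
    unfolding distr_arc by (rule AE_good)
  then show ?thesis by (rule AE_distrD[rotated]) measurable
qed

lemma AE_fst:
  assumes "AE x in gauss n. P x" shows "AE z in GG. P (fst z)"
proof -
  have "AE x in distr GG (gauss n) fst. P x"
    by (subst \<Gamma>.distr_pair_fst) (rule assms)
  then show ?thesis by (rule AE_distrD[rotated]) measurable
qed

lemma measure_shell:
  assumes "0 < s" "s < u"
  shows "measure (gauss n) {x\<in>space (gauss n). shrink n u x \<in> A \<and> shrink n s x \<notin> A} = G u - G s"
proof -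
  let ?U = "{x\<in>space (gauss n). shrink n u x \<in> A}" and ?S = "{x\<in>space (gauss n). shrink n s x \<in> A}"
  have "0 < u" using assms by simp
  have "AE x in gauss n. shrink n s x \<in> A \<longrightarrow> shrink n u x \<in> A"
    using AE_shrink_A[OF assms(1)] AE_shrink_A[OF \<open>0 < u\<close>]
    by eventually_elim (use assms shrink_mem_mono[of s u] in auto)
  then have "measure (gauss n) (?U \<inter> ?S) = G s"
    unfolding G_def by (intro \<Gamma>.finite_measure_eq_AE) auto
  moreover have "measure (gauss n) ?U = measure (gauss n) (?U \<inter> ?S) + measure (gauss n) (?U - ?S)"
    by (subst \<Gamma>.finite_measure_Union[symmetric]) (auto intro!: arg_cong[where f="measure _"])
  moreover have "?U - ?S = {x\<in>space (gauss n). shrink n u x \<in> A \<and> shrink n s x \<notin> A}" by auto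
  ultimately show ?thesis by (simp add: G_def)
qed

text \<open>The starting point decides: inside the dilate by \<open>s\<close> the ramp is 0 and
  cannot fall, outside the dilate by \<open>1 + \<eta>\<close> the far bound applies, and the near
  bound is paid only on the shell between, of measure \<open>G (1 + \<eta>) - G s\<close>.\<close>

lemma ramp_step:
  assumes r: "wide r" "0 < r" and s: "0 < s" "s < 1" and \<eta>: "0 < \<eta>"
    and \<beta>: "cos \<delta> * (1 + \<eta>) - 1 > 0"
  shows "(\<integral>\<^sup>+z. ennreal (ramp s (fst z) - ramp s (arc n \<delta> (fst z) (snd z))) \<partial>GG)
    \<le> ennreal ((G (1 + \<eta>) - G s) * (((1 - cos \<delta>) + \<bar>sin \<delta>\<bar> / r) / (1 - s))
        + (sin \<delta> / (r * (cos \<delta> * (1 + \<eta>) - 1)))\<^sup>2)"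
proof -
  define B where "B = ((1 - cos \<delta>) + \<bar>sin \<delta>\<bar> / r) / (1 - s)"
  define C where "C = (sin \<delta> / (r * (cos \<delta> * (1 + \<eta>) - 1)))\<^sup>2"
  have B: "0 \<le> B" unfolding B_def using r s by (intro divide_nonneg_pos add_nonneg_nonneg) auto
  have C: "0 \<le> C" by (simp add: C_def)
  let ?S = "{x\<in>space (gauss n). shrink n (1 + \<eta>) x \<in> A \<and> shrink n s x \<notin> A}"
  have \<eta>': "0 < 1 + \<eta>" using \<eta> by simp
  have "AE x in gauss n. AE y in gauss n. good (arc n \<delta> x y)"
    using \<Gamma>\<Gamma>.AE_pair[OF AE_arc[of \<delta>]] by simp
  then have bound: "AE x in gauss n. (\<integral>\<^sup>+y. ennreal (ramp s x - ramp s (arc n \<delta> x y)) \<partial>gauss n)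
     \<le> ennreal B * indicator ?S x + ennreal C"
    using AE_good AE_shrink_A[OF s(1)] AE_shrink_A[OF \<eta>'] AE_space
  proof eventually_elim
    case (elim x)
    consider "shrink n s x \<in> K" | "shrink n (1 + \<eta>) x \<notin> K" | "x \<in> ?S" using elim by auto
    then show ?case
    proof cases
      case 1
      then have "ramp s x = 0" using elim s by (intro ramp_inside) auto
      then have "ennreal (ramp s x - ramp s (arc n \<delta> x y)) = 0" for y
        using ramp_bounds(1)[of s "arc n \<delta> x y"] by (simp add: ennreal_neg)
      then show ?thesis by simp
    next
      case 2
      have "(\<integral>\<^sup>+y. ennreal (ramp s x - ramp s (arc n \<delta> x y)) \<partial>gauss n) \<le> ennreal C"
        unfolding C_def using elim by (intro ramp_step_far r s \<eta> \<beta> 2) auto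
      also have "\<dots> \<le> ennreal B * indicator ?S x + ennreal C" by simp
      finally show ?thesis .
    next
      case 3
      have "(\<integral>\<^sup>+y. ennreal (ramp s x - ramp s (arc n \<delta> x y)) \<partial>gauss n) \<le> ennreal B"
        unfolding B_def using elim by (intro ramp_step_near r s) auto
      also have "\<dots> \<le> ennreal B * indicator ?S x + ennreal C" using 3 by simp
      finally show ?thesis .
    qed
  qed
  have "(\<integral>\<^sup>+z. ennreal (ramp s (fst z) - ramp s (arc n \<delta> (fst z) (snd z))) \<partial>GG)
     = (\<integral>\<^sup>+x. \<integral>\<^sup>+y. ennreal (ramp s x - ramp s (arc n \<delta> x y)) \<partial>gauss n \<partial>gauss n)"
    by (subst \<Gamma>.nn_integral_fst[symmetric]) simp_all
  also have "\<dots> \<le> (\<integral>\<^sup>+x. ennreal B * indicator ?S x + ennreal C \<partial>gauss n)"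
    by (rule nn_integral_mono_AE) (rule bound)
  also have "\<dots> = ennreal B * ennreal (G (1 + \<eta>) - G s) + ennreal C"
    using s \<eta> by (simp add: nn_integral_add nn_integral_cmult_indicator \<Gamma>.emeasure_space_1
        \<Gamma>.emeasure_eq_measure \<Gamma>.prob_space measure_shell)
  also have "\<dots> = ennreal ((G (1 + \<eta>) - G s) * B + C)"
  proof -
    have "0 \<le> G (1 + \<eta>) - G s" using s \<eta> by (subst measure_shell[symmetric]) auto
    then show ?thesis using B C by (subst ennreal_plus) (auto simp: ennreal_mult' mult.commute)
  qed
  finally show ?thesis by (simp add: B_def C_def)
qed

text \<open>The great-circle arc from \<open>x\<close> to \<open>arc n \<alpha> x y\<close> is cut into \<open>N\<close> pieces; by rotation invariance
  they all contribute the same.\<close>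

lemma ramp_path:
  assumes N: "N > (0::nat)"
  shows "(\<integral>\<^sup>+z. ennreal (ramp s (arc n \<alpha> (fst z) (snd z)) - ramp s (fst z)) \<partial>GG)
    \<le> of_nat N * (\<integral>\<^sup>+z. ennreal (ramp s (fst z) - ramp s (arc n (- \<alpha> / N) (fst z) (snd z))) \<partial>GG)"
proof -
  define \<delta> where "\<delta> = \<alpha> / N"
  let ?R = "\<lambda>j z. ramp s (arc n (real j * \<delta>) (fst z) (snd z))"
  have "(\<integral>\<^sup>+z. ennreal (ramp s (arc n \<alpha> (fst z) (snd z)) - ramp s (fst z)) \<partial>GG)
     = (\<integral>\<^sup>+z. ennreal (\<Sum>j<N. ?R (Suc j) z - ?R j z) \<partial>GG)"
  proof (rule nn_integral_cong)
    fix z assume "z \<in> space GG"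
    then have "arc n 0 (fst z) (snd z) = fst z" by (intro arc_0) (auto simp: space_pair_measure)
    moreover have "real N * \<delta> = \<alpha>" using N by (simp add: \<delta>_def)
    ultimately show "ennreal (ramp s (arc n \<alpha> (fst z) (snd z)) - ramp s (fst z)) = ennreal (\<Sum>j<N. ?R (Suc j) z - ?R j z)"
      by (subst sum_lessThan_telescope) simp
  qed
  also have "\<dots> \<le> (\<integral>\<^sup>+z. (\<Sum>j<N. ennreal (?R (Suc j) z - ?R j z)) \<partial>GG)"
    by (intro nn_integral_mono ennreal_sum_le) simp
  also have "\<dots> = (\<Sum>j<N. \<integral>\<^sup>+z. ennreal (?R (Suc j) z - ?R j z) \<partial>GG)"
    by (rule nn_integral_sum) measurable
  also have "\<dots> = (\<Sum>j<N. \<integral>\<^sup>+z. ennreal (ramp s (fst z) - ramp s (arc n (- \<delta>) (fst z) (snd z))) \<partial>GG)"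
  proof (rule sum.cong[OF refl])
    fix j
    \<comment> \<open>An increase from point \<open>j\<close> to point \<open>Suc j\<close> is a
      decrease along the reversed arc, hence the angle \<open>- \<delta>\<close>.\<close>
    have "real (Suc j) * \<delta> + - \<delta> = real j * \<delta>" by (simp add: algebra_simps)
    then show "(\<integral>\<^sup>+z. ennreal (?R (Suc j) z - ?R j z) \<partial>GG) =
       (\<integral>\<^sup>+z. ennreal (ramp s (fst z) - ramp s (arc n (- \<delta>) (fst z) (snd z))) \<partial>GG)"
      using nn_integral_gauss_rotate[of "\<lambda>u v. ennreal (ramp s u - ramp s v)" n "real (Suc j) * \<delta>" "- \<delta>"]
      by simp
  qed
  finally show ?thesis by (simp add: \<delta>_def)
qed

section \<open>Exit probability along an arc\<close>

definition exit_prob :: "real \<Rightarrow> real \<Rightarrow> real" where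
  "exit_prob s \<alpha> = measure GG {z\<in>space GG. shrink n s (fst z) \<in> A \<and> arc n \<alpha> (fst z) (snd z) \<notin> A}"

text \<open>On the exit event the ramp rises from 0 to 1, up to null sets.\<close>

lemma exit_prob_le_ramp:
  assumes s: "0 < s" "s < 1"
  shows "ennreal (exit_prob s \<alpha>) \<le> (\<integral>\<^sup>+z. ennreal (ramp s (arc n \<alpha> (fst z) (snd z)) - ramp s (fst z)) \<partial>GG)"
proof -
  let ?E = "{z\<in>space GG. shrink n s (fst z) \<in> A \<and> arc n \<alpha> (fst z) (snd z) \<notin> A}"
  have [measurable]: "?E \<in> sets GG" by measurable
  have "ennreal (exit_prob s \<alpha>) = (\<integral>\<^sup>+z. indicator ?E z \<partial>GG)"
    by (simp add: exit_prob_def \<Gamma>\<Gamma>.P.emeasure_eq_measure)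
  also have "\<dots> \<le> (\<integral>\<^sup>+z. ennreal (ramp s (arc n \<alpha> (fst z) (snd z)) - ramp s (fst z)) \<partial>GG)"
  proof (rule nn_integral_mono_AE)
    from AE_arc[of \<alpha>] AE_fst[OF AE_good] AE_fst[OF AE_shrink_A[OF s(1)]]
    show "AE z in GG. indicator ?E z \<le> ennreal (ramp s (arc n \<alpha> (fst z) (snd z)) - ramp s (fst z))"
    proof eventually_elim
      case (elim z)
      show ?case
      proof (cases "z \<in> ?E")
        case True
        then have "ramp s (arc n \<alpha> (fst z) (snd z)) = 1"
          using elim s by (intro ramp_outside) (auto simp: good_def)
        moreover have "ramp s (fst z) = 0"
          using elim s True by (intro ramp_inside) auto
        ultimately show ?thesis using True by simp
      qed simp
    qed
  qed
  finally show ?thesis .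
qed

text \<open>Let the number \<open>N\<close> of pieces tend to infinity. The first-order terms
  \<open>N * \<bar>sin \<delta>\<bar>\<close> stay below \<open>\<alpha>\<close>, while
  \<open>N * (1 - cos \<delta>)\<close> and \<open>N * (sin \<delta>)\<^sup>2\<close> vanish. With
  \<open>\<eta>\<close> fixed, the margin \<open>\<beta> N\<close> tends to \<open>\<eta>\<close>
  and stays away from 0.\<close>

lemma exit_prob_le_shell:
  assumes r: "wide r" "0 < r" and s: "0 < s" "s < 1" and \<alpha>: "0 \<le> \<alpha>" and \<eta>: "0 < \<eta>"
  shows "exit_prob s \<alpha> \<le> (G (1 + \<eta>) - G s) * (\<alpha> / (r * (1 - s)))"
proof -
  define D where "D = G (1 + \<eta>) - G s"
  have D: "0 \<le> D" unfolding D_def using s \<eta> by (subst measure_shell[symmetric]) auto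
  define \<beta> where "\<beta> N = cos (\<alpha> / real N) * (1 + \<eta>) - 1" for N :: nat
  have "(\<lambda>N. \<beta> N) \<longlonglongrightarrow> cos 0 * (1 + \<eta>) - 1"
    unfolding \<beta>_def by (intro tendsto_intros lim_const_over_n)
  then have \<beta>_lim: "\<beta> \<longlonglongrightarrow> \<eta>" by simp
  then have ev: "eventually (\<lambda>N. 0 < \<beta> N) sequentially" using \<eta> by (rule order_tendstoD)
  have "eventually (\<lambda>N. exit_prob s \<alpha> \<le>
      D * ((\<alpha>\<^sup>2 / 2 / real N + \<alpha> / r) / (1 - s)) + \<alpha>\<^sup>2 / real N / (r * \<beta> N)\<^sup>2) sequentially"
    using ev eventually_gt_at_top[of 0]
  proof eventually_elim
    case (elim N)
    define \<delta> where "\<delta> = \<alpha> / real N"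
    have N: "real N > 0" using elim by simp
    define X where "X = D * (((1 - cos \<delta>) + \<bar>sin \<delta>\<bar> / r) / (1 - s)) + (sin \<delta> / (r * \<beta> N))\<^sup>2"
    have X: "0 \<le> X" unfolding X_def using D r s
      by (intro add_nonneg_nonneg mult_nonneg_nonneg divide_nonneg_pos) auto
    have "ennreal (exit_prob s \<alpha>) \<le> of_nat N * (\<integral>\<^sup>+z. ennreal (ramp s (fst z) - ramp s (arc n (- \<alpha> / N) (fst z) (snd z))) \<partial>GG)"
      using exit_prob_le_ramp[OF s, of \<alpha>] ramp_path[of N s \<alpha>] elim by (auto intro: order_trans)
    also have "\<dots> \<le> of_nat N * ennreal X"
    proof (rule mult_left_mono)
      have "0 < cos (- \<delta>) * (1 + \<eta>) - 1" using elim by (simp add: \<beta>_def \<delta>_def)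
      from ramp_step[OF r s \<eta> this] show "(\<integral>\<^sup>+z. ennreal (ramp s (fst z) - ramp s (arc n (- \<alpha> / N) (fst z) (snd z))) \<partial>GG) \<le> ennreal X"
        by (simp add: X_def D_def \<beta>_def \<delta>_def)
    qed simp
    also have "\<dots> = ennreal (real N * X)"
      using X by (simp add: ennreal_mult' ennreal_of_nat_eq_real_of_nat)
    finally have "exit_prob s \<alpha> \<le> real N * X" using X by (subst (asm) ennreal_le_iff) auto
    also have "\<dots> = D * ((real N * (1 - cos \<delta>) + real N * \<bar>sin \<delta>\<bar> / r) / (1 - s)) + real N * (sin \<delta>)\<^sup>2 / (r * \<beta> N)\<^sup>2"
      by (simp add: X_def power_divide algebra_simps add_divide_distrib diff_divide_distrib)
    also have "\<dots> \<le> D * ((\<alpha>\<^sup>2 / 2 / real N + \<alpha> / r) / (1 - s)) + \<alpha>\<^sup>2 / real N / (r * \<beta> N)\<^sup>2"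
    proof (intro add_mono mult_left_mono divide_right_mono)
      have "real N * (1 - cos \<delta>) \<le> real N * (\<delta>\<^sup>2 / 2)"
        using one_minus_cos_le by (intro mult_left_mono) auto
      also have "\<dots> = \<alpha>\<^sup>2 / 2 / real N" using N by (simp add: \<delta>_def power2_eq_square)
      finally show "real N * (1 - cos \<delta>) \<le> \<alpha>\<^sup>2 / 2 / real N" .
      have "real N * \<bar>sin \<delta>\<bar> \<le> real N * \<bar>\<delta>\<bar>"
        using abs_sin_x_le_abs_x by (intro mult_left_mono) auto
      also have "\<dots> = \<alpha>" using N \<alpha> by (simp add: \<delta>_def)
      finally show "real N * \<bar>sin \<delta>\<bar> \<le> \<alpha>" .
      have "(sin \<delta>)\<^sup>2 \<le> \<delta>\<^sup>2" using abs_sin_x_le_abs_x[of \<delta>] by (simp add: abs_le_square_iff)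
      then have "real N * (sin \<delta>)\<^sup>2 \<le> real N * \<delta>\<^sup>2" by (intro mult_left_mono) auto
      also have "\<dots> = \<alpha>\<^sup>2 / real N" using N by (simp add: \<delta>_def power2_eq_square)
      finally show "real N * (sin \<delta>)\<^sup>2 \<le> \<alpha>\<^sup>2 / real N" .
    qed (use r s D in auto)
    finally show ?case .
  qed
  moreover have "(\<lambda>N. D * ((\<alpha>\<^sup>2 / 2 / real N + \<alpha> / r) / (1 - s)) + \<alpha>\<^sup>2 / real N / (r * \<beta> N)\<^sup>2)
     \<longlonglongrightarrow> D * ((0 + \<alpha> / r) / (1 - s)) + 0 / (r * \<eta>)\<^sup>2"
    using r s \<eta> by (intro tendsto_intros lim_const_over_n \<beta>_lim) auto
  ultimately have "exit_prob s \<alpha> \<le> D * ((0 + \<alpha> / r) / (1 - s)) + 0 / (r * \<eta>)\<^sup>2"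
    by (intro tendsto_lowerbound) auto
  then show ?thesis by (simp add: D_def field_simps)
qed

text \<open>Now \<open>\<eta>\<close> tends to 0 from the right, with \<open>G (1 + \<eta>)\<close>
  controlled by \<open>G_le\<close>.\<close>

lemma exit_prob_le:
  assumes r: "wide r" "0 < r" and s: "0 < s" "s < 1" and \<alpha>: "0 \<le> \<alpha>"
  shows "exit_prob s \<alpha> \<le> (G 1 - G s) * (\<alpha> / (r * (1 - s)))"
proof -
  have "((\<lambda>\<eta>. ((1 + \<eta>) ^ n * G 1 - G s) * (\<alpha> / (r * (1 - s)))) \<longlongrightarrow> ((1 + 0) ^ n * G 1 - G s) * (\<alpha> / (r * (1 - s)))) (at_right 0)"
    by (intro tendsto_intros)
  moreover have "eventually (\<lambda>\<eta>. exit_prob s \<alpha> \<le> ((1 + \<eta>) ^ n * G 1 - G s) * (\<alpha> / (r * (1 - s)))) (at_right 0)"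
    using eventually_at_right_less[of "0::real"]
  proof eventually_elim
    case (elim \<eta>)
    have "exit_prob s \<alpha> \<le> (G (1 + \<eta>) - G s) * (\<alpha> / (r * (1 - s)))"
      using r s \<alpha> elim by (rule exit_prob_le_shell)
    also have "\<dots> \<le> ((1 + \<eta>) ^ n * G 1 - G s) * (\<alpha> / (r * (1 - s)))"
      using r s \<alpha> elim by (intro mult_right_mono diff_right_mono G_le) auto
    finally show ?case .
  qed
  ultimately show ?thesis
    by (intro tendsto_lowerbound[where F="at_right (0::real)"]) auto
qed

section \<open>Thin slabs and the choice of the width\<close>

lemma narrow_slab:
  assumes "\<not> wide w"
  obtains a where "dotp n a a = 1" "\<And>k. k \<in> K \<Longrightarrow> \<bar>dotp n a k\<bar> \<le> w"
proof -
  obtain a h where a: "dotp n a a = 1" "\<And>k. k \<in> K \<Longrightarrow> dotp n a k \<le> h" "h < w"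
    using assms unfolding wide_def by (meson not_less)
  show ?thesis
  proof
    fix k assume k: "k \<in> K"
    have "dotp n a (\<lambda>i. - k i) = - dotp n a k" by (simp add: dotp_def sum_negf)
    with a(2)[OF symm[OF k]] a(2)[OF k] a(3) show "\<bar>dotp n a k\<bar> \<le> w" by simp
  qed fact
qed

text \<open>Otherwise \<open>K\<close> would lie in arbitrarily thin slabs and have measure 0,
  against \<open>A_pos\<close>.\<close>

lemma wide_exists: "\<exists>k. wide (1 / 8 / 2 ^ k)"
proof (rule ccontr)
  assume "\<not> ?thesis"
  then have nw: "\<not> wide (1 / 8 / 2 ^ k)" for k by blast
  have "measure (gauss n) A \<le> 1 / 8 / 2 ^ k" for k
  proof -
    obtain a where a: "dotp n a a = 1" "\<And>x. x \<in> K \<Longrightarrow> \<bar>dotp n a x\<bar> \<le> 1 / 8 / 2 ^ k"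
      using narrow_slab[OF nw] by metis
    have "emeasure (gauss n) A \<le> emeasure (gauss n) {y\<in>space (gauss n). \<bar>0 + 1 * dotp n a y\<bar> \<le> 1 / 8 / 2 ^ k}"
      using AE_A by (intro emeasure_mono_AE) (auto elim!: eventually_mono dest: a(2))
    also have "\<dots> \<le> ennreal (1 / 8 / 2 ^ k / 1)"
      using a(1) by (rule gauss_slab_le) auto
    finally show ?thesis
      by (simp add: \<Gamma>.emeasure_eq_measure)
  qed
  moreover have "(\<lambda>k. 1 / 8 / 2 ^ k :: real) \<longlonglongrightarrow> 0"
    by (rule LIMSEQ_divide_realpow_zero) simp
  ultimately have "measure (gauss n) A \<le> 0"
    by (intro LIMSEQ_le_const[of _ 0]) auto
  with A_pos show False by simp
qed

lemma exit_prob_eq: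
  "ennreal (exit_prob s \<alpha>) = (\<integral>\<^sup>+x. indicator {x\<in>space (gauss n). shrink n s x \<in> A} x *
     emeasure (gauss n) {y\<in>space (gauss n). arc n \<alpha> x y \<notin> A} \<partial>gauss n)"
proof -
  let ?E = "{z\<in>space GG. shrink n s (fst z) \<in> A \<and> arc n \<alpha> (fst z) (snd z) \<notin> A}"
  have [measurable]: "?E \<in> sets GG" by measurable
  have "ennreal (exit_prob s \<alpha>) = (\<integral>\<^sup>+x. emeasure (gauss n) (Pair x -` ?E) \<partial>gauss n)"
    by (simp add: exit_prob_def \<Gamma>\<Gamma>.P.emeasure_eq_measure[symmetric] \<Gamma>.emeasure_pair_measure_alt)
  also have "\<dots> = (\<integral>\<^sup>+x. indicator {x\<in>space (gauss n). shrink n s x \<in> A} x *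
     emeasure (gauss n) {y\<in>space (gauss n). arc n \<alpha> x y \<notin> A} \<partial>gauss n)"
    by (intro nn_integral_cong)
      (auto simp: indicator_def space_pair_measure intro!: arg_cong[where f="emeasure _"])
  finally show ?thesis .
qed

text \<open>At the angle \<open>pi/2\<close> the endpoint is \<open>y\<close>, which is independent
  of \<open>x\<close>.\<close>

lemma exit_prob_quarter_turn: "exit_prob s (pi / 2) = G s * (1 - G 1)"
proof -
  have "{y\<in>space (gauss n). arc n (pi/2) x y \<notin> A} = space (gauss n) - A" for x
    by (auto simp: arc_pi_half)
  then have "ennreal (exit_prob s (pi/2)) = (\<integral>\<^sup>+x. indicator {x\<in>space (gauss n). shrink n s x \<in> A} x * ennreal (1 - G 1) \<partial>gauss n)"
    unfolding exit_prob_eq by (simp add: \<Gamma>.emeasure_eq_measure \<Gamma>.prob_compl G_1)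
  also have "\<dots> = ennreal (G s) * ennreal (1 - G 1)"
    by (subst nn_integral_multc) (auto simp: \<Gamma>.emeasure_eq_measure G_def)
  also have "\<dots> = ennreal (G s * (1 - G 1))" by (simp add: ennreal_mult' G_def)
  finally show ?thesis
    by (subst (asm) ennreal_inj) (auto simp: exit_prob_def G_def)
qed

text \<open>\<open>K\<close> lies in a slab of half-width \<open>2 * r\<close>. Given
  \<open>x\<close>, the endpoint has a normal component of standard deviation
  \<open>sin (8 * r) \<ge> 4 * r\<close> across it, so it hits the slab with probability at most
  1/2. The bound \<open>r \<le> 1 / 16\<close> is what \<open>sin_ge_half\<close> needs.\<close>

lemma exit_prob_narrow:
  assumes s: "0 < s" and r: "0 < r" "r \<le> 1 / 16" and nw: "\<not> wide (2 * r)"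
  shows "G s / 2 \<le> exit_prob s (8 * r)"
proof -
  obtain a where a: "dotp n a a = 1" "\<And>x. x \<in> K \<Longrightarrow> \<bar>dotp n a x\<bar> \<le> 2 * r"
    using narrow_slab[OF nw] by metis
  have sin: "4 * r \<le> sin (8 * r)" using sin_ge_half[of "8 * r"] r by simp
  let ?I = "\<lambda>x. {y\<in>space (gauss n). arc n (8 * r) x y \<notin> A}"
  have "AE x in gauss n. AE y in gauss n. good (arc n (8 * r) x y)"
    using \<Gamma>\<Gamma>.AE_pair[OF AE_arc[of "8 * r"]] by simp
  then have half: "AE x in gauss n. ennreal (1 / 2) \<le> emeasure (gauss n) (?I x)"
    using AE_space
  proof eventually_elim
    case (elim x)
    note [measurable] = elim(2)
    have "emeasure (gauss n) {y\<in>space (gauss n). arc n (8 * r) x y \<in> A}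
       \<le> emeasure (gauss n) {y\<in>space (gauss n). \<bar>cos (8 * r) * dotp n a x + sin (8 * r) * dotp n a y\<bar> \<le> 2 * r}"
    proof (rule emeasure_mono_AE)
      from elim(1) show "AE y in gauss n. y \<in> {y\<in>space (gauss n). arc n (8 * r) x y \<in> A} \<longrightarrow>
        y \<in> {y\<in>space (gauss n). \<bar>cos (8 * r) * dotp n a x + sin (8 * r) * dotp n a y\<bar> \<le> 2 * r}"
        by eventually_elim (auto simp: good_def dotp_arc[symmetric] intro!: a(2))
    qed measurable
    also have "\<dots> \<le> ennreal (2 * r / sin (8 * r))"
      using a(1) by (rule gauss_slab_le) (use sin r in auto)
    also have "\<dots> \<le> ennreal (1 / 2)"
      using sin r by (intro ennreal_leI) (simp add: field_simps)
    finally have *: "measure (gauss n) {y\<in>space (gauss n). arc n (8 * r) x y \<in> A} \<le> 1 / 2"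
      by (simp add: \<Gamma>.emeasure_eq_measure del: ennreal_half)
    have "measure (gauss n) (?I x) = 1 - measure (gauss n) {y\<in>space (gauss n). arc n (8 * r) x y \<in> A}"
      by (subst \<Gamma>.prob_compl[symmetric]) (auto intro!: arg_cong[where f="measure _"])
    with * show ?case by (auto simp: \<Gamma>.emeasure_eq_measure intro!: ennreal_leI simp del: ennreal_half)
  qed
  have "ennreal (G s / 2) = (\<integral>\<^sup>+x. indicator {x\<in>space (gauss n). shrink n s x \<in> A} x * ennreal (1 / 2) \<partial>gauss n)"
    by (subst nn_integral_multc)
      (auto simp: \<Gamma>.emeasure_eq_measure G_def ennreal_mult'[symmetric] simp del: ennreal_half)
  also have "\<dots> \<le> ennreal (exit_prob s (8 * r))"
    unfolding exit_prob_eq using half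
    by (intro nn_integral_mono_AE) (auto elim!: eventually_mono intro!: mult_left_mono)
  finally show ?thesis
    by (subst (asm) ennreal_le_iff) (auto simp: exit_prob_def)
qed

lemma dilation_gain:
  assumes s: "0 < s" "s < 1"
  shows "G s * (1 + (1 - s) * (1 - G 1) / 16) \<le> G 1"
proof -
  have G: "0 \<le> G s" "G s \<le> 1" "0 \<le> G 1" "G 1 \<le> 1" by (auto simp: G_def)
  have D: "0 \<le> G 1 - G s" using s by (subst measure_shell[symmetric]) auto
  \<comment> \<open>The constant 16 covers both cases: the quarter turn with \<open>r = 1/8\<close>
    costs \<open>4 * pi\<close>, and the short arc of angle \<open>8 * r\<close> costs 8, doubled by
    its probability one half.\<close>
  have "G s * (1 - G 1) \<le> (G 1 - G s) * (16 / (1 - s))"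
  proof (cases "wide (1 / 8)")
    case True
    have "G s * (1 - G 1) \<le> (G 1 - G s) * (pi / 2 / (1 / 8 * (1 - s)))"
      using exit_prob_le[OF True _ s, of "pi / 2"] by (simp add: exit_prob_quarter_turn)
    also have "\<dots> \<le> (G 1 - G s) * (16 / (1 - s))"
    proof (rule mult_left_mono[OF _ D])
      have "pi / 2 / (1 / 8 * (1 - s)) = 4 * pi / (1 - s)" by simp
      also have "\<dots> \<le> 16 / (1 - s)" using s pi_less_4 by (intro divide_right_mono) auto
      finally show "pi / 2 / (1 / 8 * (1 - s)) \<le> 16 / (1 - s)" .
    qed
    finally show ?thesis .
  next
    case False
    \<comment> \<open>The least dyadic exponent gives an \<open>r\<close> such that
      \<open>wide r\<close> holds and \<open>wide (2 * r)\<close> fails, so the exit bound and the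
      slab bound apply at the same scale.\<close>
    define k where "k = (LEAST k. wide (1 / 8 / 2 ^ k))"
    have wk: "wide (1 / 8 / 2 ^ k)"
      unfolding k_def using wide_exists by (rule LeastI_ex)
    with False obtain j where j: "k = Suc j" by (cases k) auto
    then have "j < (LEAST k. wide (1 / 8 / 2 ^ k))" by (simp only: k_def[symmetric] lessI)
    then have nw: "\<not> wide (1 / 8 / 2 ^ j)" by (rule not_less_Least)
    define r :: real where "r = 1 / 8 / 2 ^ k"
    have "(1::real) \<le> 2 ^ j" by simp
    then have r: "0 < r" "r \<le> 1 / 16" by (auto simp: r_def j field_simps)
    have "\<not> wide (2 * r)" using nw by (simp add: r_def j)
    then have "G s / 2 \<le> exit_prob s (8 * r)" using s r by (intro exit_prob_narrow) auto
    also have "\<dots> \<le> (G 1 - G s) * (8 * r / (r * (1 - s)))"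
      using wk r s by (intro exit_prob_le) (auto simp: r_def)
    also have "8 * r / (r * (1 - s)) = 8 / (1 - s)" using r by simp
    finally have "G s \<le> (G 1 - G s) * (16 / (1 - s))" by (simp add: algebra_simps)
    moreover have "G s * (1 - G 1) \<le> G s * 1" using G by (intro mult_left_mono) auto
    ultimately show ?thesis by simp
  qed
  then have "G s * (1 - G 1) * (1 - s) \<le> (G 1 - G s) * 16"
    using s by (simp add: pos_le_divide_eq)
  then show ?thesis by (simp add: field_simps)
qed

end

section \<open>The tester\<close>

text \<open>Converts the linear gain of \<open>dilation_gain\<close> into an exponential factor,
  losing a factor 2 in the exponent.\<close>

lemma exp_half_le: "0 \<le> z \<Longrightarrow> z \<le> 1 \<Longrightarrow> exp (z / 2) \<le> 1 + z" for z :: real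
proof -
  assume z: "0 \<le> z" "z \<le> 1"
  have "exp (z / 2) \<le> 1 + z / 2 + (z / 2)\<^sup>2" using z by (intro exp_bound) auto
  also have "(z / 2)\<^sup>2 \<le> z / 2"
  proof -
    have "(z / 2) * (z / 2) \<le> (z / 2) * 1" using z by (intro mult_left_mono) auto
    then show ?thesis by (simp add: power2_eq_square)
  qed
  finally show ?thesis by simp
qed

lemma gauss_eq_density:
  "gauss n = density (PiM {..<n} (\<lambda>_. lborel)) (\<lambda>x. ennreal (gaussian_density n x))"
proof -
  have "gauss n = density (PiM {..<n} (\<lambda>_. lborel)) (\<lambda>x. \<Prod>i<n. ennreal (std_normal_density (x i)))"
    unfolding gauss_def
    by (intro PiM_density lborel.sigma_finite_measure_axioms
        prob_space_imp_sigma_finite[OF prob_space_std_normal]) auto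
  then show ?thesis by (simp add: gaussian_density_def prod_ennreal)
qed

lemma measurable_gaussian_density [measurable]:
  "gaussian_density n \<in> borel_measurable (PiM {..<n} (\<lambda>_. lborel))"
  unfolding gaussian_density_def by measurable

text \<open>The density is positive everywhere, so \<open>gauss n\<close> and Lebesgue measure have
  the same null sets, and completing commutes with taking the density.\<close>

lemma std_gaussian_eq_completion: "std_gaussian n = completion (gauss n)"
  unfolding gauss_eq_density std_gaussian_def lebesgue_Rn_def
  by (intro completion_density_eq[symmetric] AE_I2)
    (auto simp: gaussian_density_def prod_pos normal_density_pos)

lemma sets_lebesgue_Rn: "sets (lebesgue_Rn n) = sets (completion (gauss n))"
  unfolding std_gaussian_eq_completion[symmetric] by (simp add: std_gaussian_def)

lemma prob_space_std_gaussian: "prob_space (std_gaussian n)"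
  unfolding std_gaussian_eq_completion by (intro prob_space.prob_space_completion prob_space_gauss)

section \<open>Truncated Gaussians\<close>

lemma truncated_gaussian_eq:
  assumes K: "K \<in> sets (lebesgue_Rn n)"
  shows "truncated_gaussian n K =
    density (std_gaussian n) (\<lambda>x. ennreal (inverse (gaussian_vol n K)) * indicator K x)"
proof -
  have [measurable]: "(\<lambda>x. ennreal (gaussian_density n x)) \<in> borel_measurable (lebesgue_Rn n)"
    unfolding lebesgue_Rn_def by (intro measurable_completion) measurable
  have "density (std_gaussian n) (\<lambda>x. ennreal (inverse (gaussian_vol n K)) * indicator K x) =
    density (lebesgue_Rn n) (\<lambda>x. ennreal (gaussian_density n x) * (ennreal (inverse (gaussian_vol n K)) * indicator K x))"
    unfolding std_gaussian_def using K by (intro density_density_eq) auto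
  also have "(\<lambda>x. ennreal (gaussian_density n x) * (ennreal (inverse (gaussian_vol n K)) * indicator K x))
     = (\<lambda>x. ennreal (inverse (gaussian_vol n K) * gaussian_density n x * indicator K x))"
    by (auto simp: fun_eq_iff indicator_def gaussian_density_def prod_nonneg gaussian_vol_def
        ennreal_mult'[symmetric] mult.commute)
  finally show ?thesis by (simp add: truncated_gaussian_def)
qed

text \<open>Moves integrals of Borel functions from the completed measure and \<open>K\<close> back
  to \<open>gauss n\<close> and the Borel set \<open>A\<close>.\<close>

lemma nn_integral_truncated_gaussian:
  assumes K: "K \<in> sets (lebesgue_Rn n)" and f[measurable]: "f \<in> borel_measurable (gauss n)"
    and A[measurable]: "A \<in> sets (gauss n)" and AE: "AE x in gauss n. x \<in> A \<longleftrightarrow> x \<in> K"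
  shows "(\<integral>\<^sup>+x. f x \<partial>truncated_gaussian n K) =
    ennreal (inverse (gaussian_vol n K)) * (\<integral>\<^sup>+x. f x * indicator A x \<partial>gauss n)"
proof -
  have K': "K \<in> sets (completion (gauss n))" using K by (simp add: sets_lebesgue_Rn)
  have f': "f \<in> borel_measurable (completion (gauss n))" by (rule measurable_completion) simp
  have "(\<integral>\<^sup>+x. f x \<partial>truncated_gaussian n K) =
      (\<integral>\<^sup>+x. ennreal (inverse (gaussian_vol n K)) * indicator K x * f x \<partial>completion (gauss n))"
    unfolding truncated_gaussian_eq[OF K] std_gaussian_eq_completion
    using K' f' by (subst nn_integral_density) auto
  also have "\<dots> = (\<integral>\<^sup>+x. ennreal (inverse (gaussian_vol n K)) * (f x * indicator A x) \<partial>gauss n)"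
    unfolding nn_integral_completion
    using AE by (intro nn_integral_cong_AE) (auto elim!: eventually_mono simp: indicator_def mult_ac)
  also have "\<dots> = ennreal (inverse (gaussian_vol n K)) * (\<integral>\<^sup>+x. f x * indicator A x \<partial>gauss n)"
    by (rule nn_integral_cmult) measurable
  finally show ?thesis .
qed

lemma borel_version:
  assumes K: "K \<in> sets (lebesgue_Rn n)"
  obtains A where "A \<in> sets (gauss n)" "AE x in gauss n. x \<in> A \<longleftrightarrow> x \<in> K"
    "gaussian_vol n K = measure (gauss n) A"
proof
  have K': "K \<in> sets (completion (gauss n))" using K by (simp add: sets_lebesgue_Rn)
  show "main_part (gauss n) K \<in> sets (gauss n)" using K' by (rule main_part_sets)
  show "AE x in gauss n. x \<in> main_part (gauss n) K \<longleftrightarrow> x \<in> K" using K' by (rule AE_in_main_part)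
  show "gaussian_vol n K = measure (gauss n) (main_part (gauss n) K)"
    using K' by (simp add: gaussian_vol_def std_gaussian_eq_completion measure_def)
qed

lemma prob_space_truncated_gaussian:
  assumes K: "K \<in> sets (lebesgue_Rn n)" and pos: "gaussian_vol n K > 0"
  shows "prob_space (truncated_gaussian n K)"
proof
  obtain A where A: "A \<in> sets (gauss n)" "AE x in gauss n. x \<in> A \<longleftrightarrow> x \<in> K"
    "gaussian_vol n K = measure (gauss n) A"
    using borel_version[OF K] .
  interpret prob_space "gauss n" by (rule prob_space_gauss)
  have "emeasure (truncated_gaussian n K) (space (truncated_gaussian n K)) = (\<integral>\<^sup>+x. 1 \<partial>truncated_gaussian n K)"
    by simp
  also have "\<dots> = 1"
    using A pos
    by (subst nn_integral_truncated_gaussian[OF K _ A(1,2)])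
      (auto simp: emeasure_eq_measure ennreal_mult'[symmetric])
  finally show "emeasure (truncated_gaussian n K) (space (truncated_gaussian n K)) = 1" .
qed

text \<open>Write v for the volume. Conditioning on \<open>K\<close> raises the mass of
  \<open>B\<close> by at most (1/v - 1) times that of \<open>B \<inter> K\<close>, hence by at most
  1 - v, and lowers it by at most the mass of \<open>B - K\<close>. So a distance of at least
  \<epsilon> forces v \<le> 1 - \<epsilon>.\<close>

lemma tv_dist_truncated_gaussian_le:
  assumes K: "K \<in> sets (lebesgue_Rn n)" and pos: "gaussian_vol n K > 0"
  shows "tv_dist (truncated_gaussian n K) (std_gaussian n) \<le> 1 - gaussian_vol n K"
  unfolding tv_dist_def
proof (rule cSUP_least)
  show "sets (truncated_gaussian n K) \<noteq> {}" by auto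
  interpret prob_space "std_gaussian n" by (rule prob_space_std_gaussian)
  let ?v = "gaussian_vol n K"
  fix B assume "B \<in> sets (truncated_gaussian n K)"
  then have B: "B \<in> events" by (simp add: truncated_gaussian_def std_gaussian_def)
  have K': "K \<in> events" using K by (simp add: std_gaussian_def)
  have "emeasure (truncated_gaussian n K) B = (\<integral>\<^sup>+x. ennreal (inverse ?v) * indicator (B \<inter> K) x \<partial>std_gaussian n)"
    unfolding truncated_gaussian_eq[OF K] using B K'
    by (subst emeasure_density) (auto intro!: nn_integral_cong simp: indicator_def)
  also have "\<dots> = ennreal (inverse ?v * prob (B \<inter> K))"
    using B K' pos by (subst nn_integral_cmult_indicator) (auto simp: emeasure_eq_measure ennreal_mult')
  finally have D: "measure (truncated_gaussian n K) B = inverse ?v * prob (B \<inter> K)"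
    using pos by (simp add: measure_def)
  have v: "?v = prob K" by (simp add: gaussian_vol_def)
  have le: "prob (B \<inter> K) \<le> ?v" unfolding v using B K' by (intro finite_measure_mono) auto
  have "prob B = prob (B \<inter> K) + prob (B - K)"
    using B K' by (subst finite_measure_Union[symmetric]) (auto intro!: arg_cong[where f=prob])
  moreover have "prob (B - K) \<le> prob (space (std_gaussian n) - K)"
    using B K' sets.sets_into_space[OF B] by (intro finite_measure_mono) auto
  moreover have "prob (space (std_gaussian n) - K) = 1 - ?v" unfolding v using K' by (rule prob_compl)
  ultimately have b: "prob (B \<inter> K) \<le> prob B" "prob B \<le> prob (B \<inter> K) + (1 - ?v)"
    by (auto simp: measure_nonneg)
  have v1: "?v \<le> 1" by (simp add: v)
  then have "1 \<le> inverse ?v" using pos by (simp add: one_le_inverse_iff)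
  then have "1 * prob (B \<inter> K) \<le> inverse ?v * prob (B \<inter> K)" by (intro mult_right_mono) auto
  moreover have "inverse ?v * prob (B \<inter> K) - prob (B \<inter> K) = (inverse ?v - 1) * prob (B \<inter> K)"
    by (simp add: algebra_simps)
  moreover have "(inverse ?v - 1) * prob (B \<inter> K) \<le> (inverse ?v - 1) * ?v"
    using \<open>1 \<le> inverse ?v\<close> le by (intro mult_left_mono) auto
  moreover have "(inverse ?v - 1) * ?v = 1 - ?v" using pos by (simp add: algebra_simps)
  ultimately show "\<bar>measure (truncated_gaussian n K) B - prob B\<bar> \<le> 1 - ?v"
    unfolding D using b by linarith
qed

section \<open>Exponential moments of the squared norm\<close>

lemma nn_integral_exp_gauss:
  assumes "\<tau> \<ge> 0"
  shows "(\<integral>\<^sup>+x. ennreal (exp (- \<tau> * (\<Sum>i<n. (x i)\<^sup>2))) \<partial>gauss n) \<le> ennreal (exp (- real n * (\<tau> - 2 * \<tau>\<^sup>2)))"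
proof -
  \<comment> \<open>With this \<open>t\<close> the dilated Gaussian has density t^n exp (- \<tau>
    |x|^2). Its total mass 1 gives the exact moment t^(-n).\<close>
  define t where "t = sqrt (1 + 2 * \<tau>)"
  have t: "t > 0" "t\<^sup>2 = 1 + 2 * \<tau>" using assms by (auto simp: t_def)
  interpret prob_space "gauss n" by (rule prob_space_gauss)
  have e: "(1 - t\<^sup>2) / 2 = - \<tau>" using t by simp
  have "1 = emeasure (distr (gauss n) (gauss n) (shrink n t)) (space (gauss n))"
    using prob_space.emeasure_space_1[OF prob_space_distr[of "shrink n t" "gauss n"]] by simp
  also have "\<dots> = (\<integral>\<^sup>+x. ennreal (t ^ n) * ennreal (exp (- \<tau> * (\<Sum>i<n. (x i)\<^sup>2))) \<partial>gauss n)"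
    unfolding distr_gauss_shrink[OF t(1)] e using t
    by (subst emeasure_density) (auto intro!: nn_integral_cong simp: ennreal_mult')
  also have "\<dots> = ennreal (t ^ n) * (\<integral>\<^sup>+x. ennreal (exp (- \<tau> * (\<Sum>i<n. (x i)\<^sup>2))) \<partial>gauss n)"
    by (rule nn_integral_cmult) measurable
  finally have "ennreal (inverse (t ^ n)) * 1 = ennreal (inverse (t ^ n)) * (ennreal (t ^ n) * (\<integral>\<^sup>+x. ennreal (exp (- \<tau> * (\<Sum>i<n. (x i)\<^sup>2))) \<partial>gauss n))"
    by simp
  also have "\<dots> = (\<integral>\<^sup>+x. ennreal (exp (- \<tau> * (\<Sum>i<n. (x i)\<^sup>2))) \<partial>gauss n)"
    using t by (simp add: mult.assoc[symmetric] ennreal_mult'[symmetric])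
  finally have eq: "(\<integral>\<^sup>+x. ennreal (exp (- \<tau> * (\<Sum>i<n. (x i)\<^sup>2))) \<partial>gauss n) = ennreal (inverse (t ^ n))"
    by simp
  have "exp (\<tau> - 2 * \<tau>\<^sup>2) \<le> t"
  \<comment> \<open>The logarithm estimate needs \<open>2 * \<tau> \<le> 1\<close>; for larger
    \<open>\<tau>\<close> the exponent on the left is not positive.\<close>
  proof (cases "\<tau> \<le> 1 / 2")
    case True
    have "2 * \<tau> - (2 * \<tau>)\<^sup>2 \<le> ln (1 + 2 * \<tau>)"
      using assms True by (intro ln_one_plus_pos_lower_bound) auto
    then have "exp (2 * \<tau> - (2 * \<tau>)\<^sup>2) \<le> 1 + 2 * \<tau>"
      using assms by (simp add: ln_ge_iff)
    moreover have "exp (2 * \<tau> - (2 * \<tau>)\<^sup>2) = (exp (\<tau> - 2 * \<tau>\<^sup>2))\<^sup>2"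
      by (simp add: exp_double[symmetric] algebra_simps power_mult_distrib)
    ultimately show ?thesis unfolding t_def by (intro real_le_rsqrt) simp
  next
    case False
    then have "\<tau> * 1 \<le> \<tau> * (2 * \<tau>)" by (intro mult_left_mono) auto
    then have "exp (\<tau> - 2 * \<tau>\<^sup>2) \<le> 1" by (simp add: power2_eq_square)
    also have "1 \<le> t" unfolding t_def using assms by simp
    finally show ?thesis .
  qed
  then have "exp (\<tau> - 2 * \<tau>\<^sup>2) ^ n \<le> t ^ n" by (intro power_mono) auto
  then have "inverse (t ^ n) \<le> inverse (exp (\<tau> - 2 * \<tau>\<^sup>2) ^ n)"
    by (intro le_imp_inverse_le) auto
  also have "\<dots> = exp (- real n * (\<tau> - 2 * \<tau>\<^sup>2))"
    by (simp add: exp_of_nat_mult[symmetric] exp_minus[symmetric])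
  finally show ?thesis unfolding eq by (rule ennreal_leI)
qed

text \<open>The locale works with total functions, so \<open>K\<close> is replaced by the cylinder
  over it. The two agree on \<open>space (gauss n)\<close>, whose elements equal their
  restrictions.\<close>

lemma symm_convex_body_truncation:
  assumes K: "K \<in> sets (lebesgue_Rn n)" and pos: "gaussian_vol n K > 0"
    and sym: "symmetric_Rn n K" and conv: "convex_Rn n K" and n: "n > 0"
    and A: "A \<in> sets (gauss n)" "AE x in gauss n. x \<in> A \<longleftrightarrow> x \<in> K"
    and vol: "gaussian_vol n K = measure (gauss n) A"
  shows "symm_convex_body n {x. restrict x {..<n} \<in> K} A"
proof
  show "convex_fun_set {x. restrict x {..<n} \<in> K}"
    unfolding convex_fun_set_def
  proof safe
    fix x y :: "nat \<Rightarrow> real" and u v :: real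
    assume *: "restrict x {..<n} \<in> K" "restrict y {..<n} \<in> K" "0 \<le> u" "0 \<le> v" "u + v = 1"
    then have "(\<lambda>i\<in>{..<n}. u * restrict x {..<n} i + v * restrict y {..<n} i) \<in> K"
      using conv unfolding convex_Rn_def by blast
    then show "(\<lambda>i\<in>{..<n}. u * x i + v * y i) \<in> K"
      by (simp cong: restrict_cong)
  qed
  show "(\<lambda>i. - x i) \<in> {x. restrict x {..<n} \<in> K}" if "x \<in> {x. restrict x {..<n} \<in> K}" for x
  proof -
    have "(\<lambda>i\<in>{..<n}. - restrict x {..<n} i) \<in> K"
      using sym that unfolding symmetric_Rn_def by blast
    then show ?thesis by (simp cong: restrict_cong)
  qed
  show "y \<in> {x. restrict x {..<n} \<in> K}"
    if "\<And>i. i < n \<Longrightarrow> x i = y i" "x \<in> {x. restrict x {..<n} \<in> K}" for x y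
  proof -
    have "restrict x {..<n} = restrict y {..<n}" using that(1) by (intro restrict_ext) auto
    with that(2) show ?thesis by simp
  qed
  show "AE x in gauss n. x \<in> A \<longleftrightarrow> x \<in> {x. restrict x {..<n} \<in> K}"
    using A(2) AE_space
  proof eventually_elim
    case (elim x)
    then have "restrict x {..<n} = x" by (auto simp: space_gauss PiE_def extensional_restrict)
    with elim show ?case by simp
  qed
qed (use n A pos vol in auto)

text \<open>The moment is \<open>G s / (s ^ n * G 1)\<close> with s^2 = 1 - 2 \<tau>. The factor
  s^(-n) is bounded as without truncation, and the saving \<tau> \<epsilon> / 32 comes from
  \<open>dilation_gain\<close> with 1 - s \<ge> \<tau> and 1 - \<open>G 1\<close> \<ge>
  \<epsilon>.\<close>

lemma nn_integral_exp_truncated_gaussian: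
  assumes K: "K \<in> sets (lebesgue_Rn n)" and pos: "gaussian_vol n K > 0"
    and sym: "symmetric_Rn n K" and conv: "convex_Rn n K" and n: "n > 0"
    and \<tau>: "0 < \<tau>" "\<tau> \<le> 1 / 4" and \<epsilon>: "0 \<le> \<epsilon>" "\<epsilon> \<le> 1 - gaussian_vol n K"
  shows "(\<integral>\<^sup>+x. ennreal (exp (\<tau> * (\<Sum>i<n. (x i)\<^sup>2))) \<partial>truncated_gaussian n K)
    \<le> ennreal (exp (real n * (\<tau> + 4 * \<tau>\<^sup>2) - \<tau> * \<epsilon> / 32))"
proof -
  obtain A where AK: "A \<in> sets (gauss n)" "AE x in gauss n. x \<in> A \<longleftrightarrow> x \<in> K"
    and vol: "gaussian_vol n K = measure (gauss n) A"
    using borel_version[OF K] .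
  interpret symm_convex_body n "{x. restrict x {..<n} \<in> K}" A
    by (rule symm_convex_body_truncation[OF K pos sym conv n AK vol])
  define s where "s = sqrt (1 - 2 * \<tau>)"
  have s2: "s\<^sup>2 = 1 - 2 * \<tau>" using \<tau> by (simp add: s_def)
  have s: "0 < s" "s < 1" using \<tau> by (auto simp: s_def)
  have s_le: "s \<le> 1 - \<tau>"
    unfolding s_def using \<tau> by (intro real_le_lsqrt) (auto simp: power2_eq_square algebra_simps)
  have e: "(1 - s\<^sup>2) / 2 = \<tau>" by (simp add: s2)
  define v where "v = gaussian_vol n K"
  have v: "v = G 1" "0 < v" "v \<le> 1" "\<epsilon> \<le> 1 - v" using pos \<epsilon> vol by (auto simp: v_def G_1)
  have "ennreal (s ^ n) * (\<integral>\<^sup>+x. ennreal (exp (\<tau> * (\<Sum>i<n. (x i)\<^sup>2))) * indicator A x \<partial>gauss n) = ennreal (G s)"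
    unfolding emeasure_G[OF s(1)] e using s AK(1)
    by (subst nn_integral_cmult[symmetric]) (auto intro!: nn_integral_cong simp: ennreal_mult' mult.assoc)
  then have "ennreal (inverse (s ^ n)) * ennreal (G s) = ennreal (inverse (s ^ n)) * (ennreal (s ^ n) * (\<integral>\<^sup>+x. ennreal (exp (\<tau> * (\<Sum>i<n. (x i)\<^sup>2))) * indicator A x \<partial>gauss n))"
    by simp
  also have "\<dots> = (\<integral>\<^sup>+x. ennreal (exp (\<tau> * (\<Sum>i<n. (x i)\<^sup>2))) * indicator A x \<partial>gauss n)"
    using s by (simp add: mult.assoc[symmetric] ennreal_mult'[symmetric])
  finally have "(\<integral>\<^sup>+x. ennreal (exp (\<tau> * (\<Sum>i<n. (x i)\<^sup>2))) \<partial>truncated_gaussian n K)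
     = ennreal (inverse v) * (ennreal (inverse (s ^ n)) * ennreal (G s))"
    by (subst nn_integral_truncated_gaussian[OF K _ AK]) (simp_all add: v_def)
  also have "\<dots> = ennreal (inverse (s ^ n) * (G s / v))"
    using v s by (simp add: ennreal_mult'[symmetric] G_def field_simps)
  also have "\<dots> \<le> ennreal (exp (real n * (\<tau> + 4 * \<tau>\<^sup>2)) * exp (- (\<tau> * \<epsilon> / 32)))"
  proof (intro ennreal_leI mult_mono)
    have "- (2 * \<tau>) - 2 * (2 * \<tau>)\<^sup>2 \<le> ln (1 - 2 * \<tau>)"
      using \<tau> by (intro ln_one_minus_pos_lower_bound) auto
    then have "exp (- (2 * \<tau>) - 2 * (2 * \<tau>)\<^sup>2) \<le> 1 - 2 * \<tau>"
      using \<tau> by (simp add: ln_ge_iff)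
    moreover have "exp (- (2 * \<tau>) - 2 * (2 * \<tau>)\<^sup>2) = (exp (- (\<tau> + 4 * \<tau>\<^sup>2)))\<^sup>2"
      by (simp add: exp_double[symmetric] algebra_simps power_mult_distrib)
    ultimately have "exp (- (\<tau> + 4 * \<tau>\<^sup>2)) \<le> s" unfolding s_def by (intro real_le_rsqrt) simp
    then have "exp (- (\<tau> + 4 * \<tau>\<^sup>2)) ^ n \<le> s ^ n" by (intro power_mono) auto
    then have "inverse (s ^ n) \<le> inverse (exp (- (\<tau> + 4 * \<tau>\<^sup>2)) ^ n)"
      by (intro le_imp_inverse_le) auto
    also have "\<dots> = exp (real n * (\<tau> + 4 * \<tau>\<^sup>2))"
      by (simp add: exp_of_nat_mult[symmetric] exp_minus[symmetric] algebra_simps)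
    finally show "inverse (s ^ n) \<le> exp (real n * (\<tau> + 4 * \<tau>\<^sup>2))" .
    have "\<tau> * \<epsilon> \<le> 1 * 1" using \<tau> \<epsilon> v by (intro mult_mono) auto
    then have "exp (\<tau> * \<epsilon> / 16 / 2) \<le> 1 + \<tau> * \<epsilon> / 16" using \<tau> \<epsilon> by (intro exp_half_le) auto
    also have "\<tau> * \<epsilon> \<le> (1 - s) * (1 - G 1)" using s_le v \<tau> \<epsilon> by (intro mult_mono) auto
    finally have ex: "exp (\<tau> * \<epsilon> / 32) \<le> 1 + (1 - s) * (1 - G 1) / 16" by simp
    have "G s * exp (\<tau> * \<epsilon> / 32) \<le> G s * (1 + (1 - s) * (1 - G 1) / 16)"
      using ex by (intro mult_left_mono) (auto simp: G_def)
    also have "\<dots> \<le> v" unfolding v(1) by (rule dilation_gain[OF s])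
    finally show "G s / v \<le> exp (- (\<tau> * \<epsilon> / 32))"
      using v by (simp add: exp_minus field_simps)
  qed (use v in \<open>auto simp: G_def\<close>)
  also have "\<dots> = ennreal (exp (real n * (\<tau> + 4 * \<tau>\<^sup>2) - \<tau> * \<epsilon> / 32))"
    by (simp add: mult_exp_exp)
  finally show ?thesis .
qed

section \<open>Chernoff bounds for the two errors\<close>

lemma chernoff_product:
  assumes D: "prob_space D" and g[measurable]: "g \<in> borel_measurable D"
    and q: "0 \<le> q" "(\<integral>\<^sup>+x. ennreal (exp (g x)) \<partial>D) \<le> ennreal q"
  shows "measure (PiM {..<T} (\<lambda>_. D)) {x\<in>space (PiM {..<T} (\<lambda>_. D)). (\<Sum>j<T. g (x j)) \<ge> 0} \<le> q ^ T"
proof -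
  interpret D: product_prob_space "\<lambda>_::nat. D" by (rule product_prob_spaceI) (rule D)
  interpret P: prob_space "PiM {..<T} (\<lambda>_. D)" by (rule prob_space_PiM) (rule D)
  let ?P = "PiM {..<T} (\<lambda>_. D)" and ?E = "{x\<in>space (PiM {..<T} (\<lambda>_. D)). (\<Sum>j<T. g (x j)) \<ge> 0}"
  have [measurable]: "?E \<in> sets ?P" by measurable
  have "emeasure ?P ?E = (\<integral>\<^sup>+x. indicator ?E x \<partial>?P)" by simp
  \<comment> \<open>On the event the product of the exponentials is at least 1; by independence its
    integral then factorises.\<close>
  also have "\<dots> \<le> (\<integral>\<^sup>+x. (\<Prod>j<T. ennreal (exp (g (x j)))) \<partial>?P)"
    by (intro nn_integral_mono) (auto simp: indicator_def prod_ennreal exp_sum[symmetric])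
  also have "\<dots> = (\<Prod>j<T. \<integral>\<^sup>+x. ennreal (exp (g x)) \<partial>D)"
    by (intro D.product_nn_integral_prod) auto
  also have "\<dots> \<le> (\<Prod>j<T. ennreal q)"
    using q by (intro prod_mono_ennreal) auto
  also have "\<dots> = ennreal (q ^ T)" using q by (simp add: ennreal_power)
  finally show ?thesis using q by (simp add: P.emeasure_eq_measure)
qed

lemma L2_set_square: "(L2_set x {..<n})\<^sup>2 = (\<Sum>i<n. (x i)\<^sup>2)"
  by (simp add: L2_set_def sum_nonneg)

lemma num_samples_bounds:
  assumes "n > 0" "\<epsilon> > 0" "C > 0"
  shows "num_samples C n \<epsilon> > 0" "C \<le> real (num_samples C n \<epsilon>) * (\<epsilon>\<^sup>2 / real n)"
proof -
  have pos: "0 < C * real n / \<epsilon>\<^sup>2" using assms by simp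
  then show "num_samples C n \<epsilon> > 0" unfolding num_samples_def by simp
  have "C * real n / \<epsilon>\<^sup>2 \<le> real (num_samples C n \<epsilon>)"
    unfolding num_samples_def by (rule real_nat_ceiling_ge)
  then show "C \<le> real (num_samples C n \<epsilon>) * (\<epsilon>\<^sup>2 / real n)"
    using assms by (simp add: field_simps)
qed

lemma mean_sq_norm_ge_iff:
  assumes "T > 0"
  shows "mean_sq_norm n T x \<ge> b \<longleftrightarrow> (\<Sum>j<T. (\<Sum>i<n. (x j i)\<^sup>2) - b) \<ge> 0"
  using assms by (simp add: mean_sq_norm_def L2_set_square sum_subtractf field_simps)

lemma exp_minus_four_power_le:
  assumes q: "0 \<le> q" "q \<le> exp (- a)" and T: "4 \<le> real T * a"
  shows "q ^ T \<le> 1 / 10"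
proof -
  have "q ^ T \<le> exp (- a) ^ T" using q by (rule power_mono[rotated])
  also have "\<dots> = exp (- (real T * a))" by (simp add: exp_of_nat_mult[symmetric])
  also have "\<dots> \<le> exp (- 4)" using T by simp
  also have "\<dots> \<le> 1 / 10"
    \<comment> \<open>The quadratic Taylor polynomial gives exp 4 \<ge> 1 + 4 + 8 = 13.\<close>
    using exp_lower_Taylor_quadratic[of 4] by (simp add: exp_minus field_simps)
  finally show ?thesis .
qed

lemma product_event_ge:
  assumes D: "prob_space D" and E: "{x\<in>space (PiM {..<T} (\<lambda>_. D)). P x} \<in> sets (PiM {..<T} (\<lambda>_. D))"
    and b: "measure (PiM {..<T} (\<lambda>_. D)) {x\<in>space (PiM {..<T} (\<lambda>_. D)). P x} \<le> 1 / 10"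
  shows "measure (PiM {..<T} (\<lambda>_. D)) {x\<in>space (PiM {..<T} (\<lambda>_. D)). \<not> P x} \<ge> 9 / 10"
proof -
  interpret P: prob_space "PiM {..<T} (\<lambda>_. D)" by (rule prob_space_PiM) (rule D)
  have "{x\<in>space (PiM {..<T} (\<lambda>_. D)). \<not> P x} = space (PiM {..<T} (\<lambda>_. D)) - {x\<in>space (PiM {..<T} (\<lambda>_. D)). P x}"
    by auto
  then show ?thesis using P.prob_compl[OF E] b by simp
qed

lemma measurable_sq_norm_completion:
  assumes "sets D = sets (completion (gauss n))"
  shows "(\<lambda>x. \<Sum>i<n. (x i)\<^sup>2) \<in> borel_measurable D"
  using measurable_completion[OF measurable_sum_squares] measurable_cong_sets[OF assms refl] by blast

lemma untruncated_case:
  fixes n :: nat and \<epsilon> :: real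
  assumes n: "n > 0" and \<epsilon>: "\<epsilon> > 0"
  shows "symm_tester_prob (1 / 32) (2 ^ 18) n \<epsilon> (std_gaussian n) Untruncated \<ge> 9 / 10"
proof -
  define T where "T = num_samples (2 ^ 18) n \<epsilon>"
  define b where "b = real n - 1 / 32 * \<epsilon> / 2"
  \<comment> \<open>The minimiser of the exponent 2 n \<tau>^2 - \<tau> \<epsilon> / 64, with value
    - \<epsilon>^2 / (2^15 n).\<close>
  define \<tau> where "\<tau> = \<epsilon> / (256 * real n)"
  define g where "g x = \<tau> * (b - (\<Sum>i<n. (x i)\<^sup>2))" for x :: "nat \<Rightarrow> real"
  let ?D = "std_gaussian n"
  let ?P = "PiM {..<T} (\<lambda>_. ?D)"
  have T: "T > 0" "2 ^ 18 \<le> real T * (\<epsilon>\<^sup>2 / real n)"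
    using num_samples_bounds[OF n \<epsilon>, of "2 ^ 18"] by (auto simp: T_def)
  have \<tau>: "\<tau> > 0" using n \<epsilon> by (simp add: \<tau>_def)
  have [measurable]: "(\<lambda>x. \<Sum>i<n. (x i)\<^sup>2) \<in> borel_measurable ?D"
    by (rule measurable_sq_norm_completion) (simp add: std_gaussian_eq_completion)
  have [measurable]: "g \<in> borel_measurable ?D" unfolding g_def by measurable
  have "(\<integral>\<^sup>+x. ennreal (exp (g x)) \<partial>?D) = (\<integral>\<^sup>+x. ennreal (exp (\<tau> * b)) * ennreal (exp (- \<tau> * (\<Sum>i<n. (x i)\<^sup>2))) \<partial>gauss n)"
    unfolding std_gaussian_eq_completion nn_integral_completion
    by (intro nn_integral_cong) (simp add: g_def ennreal_mult'[symmetric] mult_exp_exp algebra_simps)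
  also have "\<dots> = ennreal (exp (\<tau> * b)) * (\<integral>\<^sup>+x. ennreal (exp (- \<tau> * (\<Sum>i<n. (x i)\<^sup>2))) \<partial>gauss n)"
    by (rule nn_integral_cmult) measurable
  also have "\<dots> \<le> ennreal (exp (\<tau> * b)) * ennreal (exp (- real n * (\<tau> - 2 * \<tau>\<^sup>2)))"
    using \<tau> by (intro mult_left_mono nn_integral_exp_gauss) auto
  also have "\<dots> = ennreal (exp (\<tau> * b - real n * (\<tau> - 2 * \<tau>\<^sup>2)))"
    by (simp add: ennreal_mult'[symmetric] mult_exp_exp)
  also have "\<tau> * b - real n * (\<tau> - 2 * \<tau>\<^sup>2) = - (\<epsilon>\<^sup>2 / real n / 2 ^ 15)"
    using n by (simp add: \<tau>_def b_def power2_eq_square field_simps)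
  finally have int: "(\<integral>\<^sup>+x. ennreal (exp (g x)) \<partial>?D) \<le> ennreal (exp (- (\<epsilon>\<^sup>2 / real n / 2 ^ 15)))" .
  have "measure ?P {x\<in>space ?P. (\<Sum>j<T. g (x j)) \<ge> 0} \<le> exp (- (\<epsilon>\<^sup>2 / real n / 2 ^ 15)) ^ T"
    by (intro chernoff_product prob_space_std_gaussian int) auto
  also have "\<dots> \<le> 1 / 10"
  proof (rule exp_minus_four_power_le)
    have "4 \<le> real T * (\<epsilon>\<^sup>2 / real n) / 2 ^ 15" using T(2) by (subst pos_le_divide_eq) simp_all
    then show "4 \<le> real T * (\<epsilon>\<^sup>2 / real n / 2 ^ 15)" by (simp only: times_divide_eq_right)
  qed simp_all
  finally have "measure ?P {x\<in>space ?P. \<not> (\<Sum>j<T. g (x j)) \<ge> 0} \<ge> 9 / 10"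
    by (intro product_event_ge prob_space_std_gaussian) auto
  \<comment> \<open>Only an inclusion: the Chernoff event also contains the tie where the mean
    equals \<open>b\<close>, which the tester accepts.\<close>
  also have "measure ?P {x\<in>space ?P. \<not> (\<Sum>j<T. g (x j)) \<ge> 0} \<le> measure ?P {x\<in>space ?P. symm_tester (1 / 32) (2 ^ 18) n \<epsilon> x = Untruncated}"
  proof (rule finite_measure.finite_measure_mono)
    show "finite_measure ?P"
      by (intro prob_space.finite_measure prob_space_PiM prob_space_std_gaussian)
    have eq: "symm_tester (1 / 32) (2 ^ 18) n \<epsilon> x = Untruncated \<longleftrightarrow> (\<Sum>j<T. (\<Sum>i<n. (x j i)\<^sup>2) - b) \<ge> 0" for x
      using mean_sq_norm_ge_iff[OF T(1), of b n x] by (simp add: symm_tester_def T_def b_def)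
    show "{x\<in>space ?P. symm_tester (1 / 32) (2 ^ 18) n \<epsilon> x = Untruncated} \<in> sets ?P"
      unfolding eq by measurable
    have "(\<Sum>j<T. g (x j)) = - \<tau> * (\<Sum>j<T. (\<Sum>i<n. (x j i)\<^sup>2) - b)" for x
      unfolding g_def sum_distrib_left[of "- \<tau>"] by (intro sum.cong) (auto simp: right_diff_distrib)
    then show "{x\<in>space ?P. \<not> (\<Sum>j<T. g (x j)) \<ge> 0} \<subseteq> {x\<in>space ?P. symm_tester (1 / 32) (2 ^ 18) n \<epsilon> x = Untruncated}"
      unfolding eq using \<tau> by (auto simp: not_le mult_less_0_iff zero_less_mult_iff)
  qed
  finally show ?thesis by (simp add: symm_tester_prob_def T_def)
qed

lemma truncated_case:
  fixes n :: nat and \<epsilon> :: real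
  assumes K: "K \<in> sets (lebesgue_Rn n)" and pos: "gaussian_vol n K > 0"
    and sym: "symmetric_Rn n K" and conv: "convex_Rn n K"
    and n: "n > 0" and \<epsilon>: "\<epsilon> > 0" "\<epsilon> \<le> 1 - gaussian_vol n K"
  shows "symm_tester_prob (1 / 32) (2 ^ 18) n \<epsilon> (truncated_gaussian n K) Truncated \<ge> 9 / 10"
proof -
  define T where "T = num_samples (2 ^ 18) n \<epsilon>"
  define b where "b = real n - 1 / 32 * \<epsilon> / 2"
  \<comment> \<open>The threshold gives up \<epsilon> / 64 of the saving \<epsilon> / 32. What
    remains is the exponent 4 n \<tau>^2 - \<tau> \<epsilon> / 64, minimal at this
    \<open>\<tau>\<close> with value - \<epsilon>^2 / (2^16 n).\<close>
  define \<tau> where "\<tau> = \<epsilon> / (512 * real n)"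
  define g where "g x = \<tau> * ((\<Sum>i<n. (x i)\<^sup>2) - b)" for x :: "nat \<Rightarrow> real"
  let ?D = "truncated_gaussian n K"
  let ?P = "PiM {..<T} (\<lambda>_. ?D)"
  have pr: "prob_space ?D" using K pos by (rule prob_space_truncated_gaussian)
  have T: "T > 0" "2 ^ 18 \<le> real T * (\<epsilon>\<^sup>2 / real n)"
    using num_samples_bounds[OF n \<epsilon>(1), of "2 ^ 18"] by (auto simp: T_def)
  have \<tau>: "\<tau> > 0" "\<tau> \<le> 1 / 4"
  proof -
    show "\<tau> > 0" using n \<epsilon> by (simp add: \<tau>_def)
    have "\<epsilon> \<le> 1" "1 \<le> real n" using \<epsilon> pos n by auto
    then show "\<tau> \<le> 1 / 4" by (simp add: \<tau>_def field_simps)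
  qed
  have [measurable]: "(\<lambda>x. \<Sum>i<n. (x i)\<^sup>2) \<in> borel_measurable ?D"
    by (rule measurable_sq_norm_completion) (simp add: truncated_gaussian_def sets_lebesgue_Rn)
  have [measurable]: "g \<in> borel_measurable ?D" unfolding g_def by measurable
  have "(\<integral>\<^sup>+x. ennreal (exp (g x)) \<partial>?D) = (\<integral>\<^sup>+x. ennreal (exp (- \<tau> * b)) * ennreal (exp (\<tau> * (\<Sum>i<n. (x i)\<^sup>2))) \<partial>?D)"
    by (intro nn_integral_cong) (simp add: g_def ennreal_mult'[symmetric] mult_exp_exp algebra_simps)
  also have "\<dots> = ennreal (exp (- \<tau> * b)) * (\<integral>\<^sup>+x. ennreal (exp (\<tau> * (\<Sum>i<n. (x i)\<^sup>2))) \<partial>?D)"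
    by (rule nn_integral_cmult) measurable
  also have "\<dots> \<le> ennreal (exp (- \<tau> * b)) * ennreal (exp (real n * (\<tau> + 4 * \<tau>\<^sup>2) - \<tau> * \<epsilon> / 32))"
    using \<tau> \<epsilon> by (intro mult_left_mono nn_integral_exp_truncated_gaussian K pos sym conv n) auto
  also have "\<dots> = ennreal (exp (- \<tau> * b + (real n * (\<tau> + 4 * \<tau>\<^sup>2) - \<tau> * \<epsilon> / 32)))"
    by (simp add: ennreal_mult'[symmetric] mult_exp_exp)
  also have "- \<tau> * b + (real n * (\<tau> + 4 * \<tau>\<^sup>2) - \<tau> * \<epsilon> / 32) = - (\<epsilon>\<^sup>2 / real n / 2 ^ 16)"
    using n by (simp add: \<tau>_def b_def power2_eq_square field_simps)
  finally have int: "(\<integral>\<^sup>+x. ennreal (exp (g x)) \<partial>?D) \<le> ennreal (exp (- (\<epsilon>\<^sup>2 / real n / 2 ^ 16)))" .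
  have "measure ?P {x\<in>space ?P. (\<Sum>j<T. g (x j)) \<ge> 0} \<le> exp (- (\<epsilon>\<^sup>2 / real n / 2 ^ 16)) ^ T"
    by (intro chernoff_product pr int) auto
  also have "\<dots> \<le> 1 / 10"
  proof (rule exp_minus_four_power_le)
    have "4 \<le> real T * (\<epsilon>\<^sup>2 / real n) / 2 ^ 16" using T(2) by (subst pos_le_divide_eq) simp_all
    then show "4 \<le> real T * (\<epsilon>\<^sup>2 / real n / 2 ^ 16)" by (simp only: times_divide_eq_right)
  qed simp_all
  finally have "measure ?P {x\<in>space ?P. \<not> (\<Sum>j<T. g (x j)) \<ge> 0} \<ge> 9 / 10"
    by (intro product_event_ge pr) auto
  moreover have "symm_tester (1 / 32) (2 ^ 18) n \<epsilon> x = Truncated \<longleftrightarrow> \<not> (\<Sum>j<T. g (x j)) \<ge> 0" for x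
  proof -
    have "(\<Sum>j<T. g (x j)) = \<tau> * (\<Sum>j<T. (\<Sum>i<n. (x j i)\<^sup>2) - b)"
      by (simp add: g_def sum_distrib_left)
    then have "(\<Sum>j<T. g (x j)) \<ge> 0 \<longleftrightarrow> (\<Sum>j<T. (\<Sum>i<n. (x j i)\<^sup>2) - b) \<ge> 0"
      using \<tau> by (simp only: zero_le_mult_iff) auto
    then show ?thesis
      using mean_sq_norm_ge_iff[OF T(1), of b n x] by (simp add: symm_tester_def T_def b_def)
  qed
  ultimately show ?thesis by (simp add: symm_tester_prob_def T_def)
qed

section \<open>Dimension 0 and the theorem\<close>

lemma symm_tester_prob_dim_0:
  assumes "prob_space D" "c > 0" "\<epsilon> > 0"
  shows "symm_tester_prob c C 0 \<epsilon> D Untruncated = 1"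
proof -
  interpret P: prob_space "PiM {..<num_samples C 0 \<epsilon>} (\<lambda>_. D)" by (rule prob_space_PiM) (rule assms)
  \<comment> \<open>All norms are empty sums, so the mean is 0 whatever the samples, and the
    threshold is negative.\<close>
  have "symm_tester c C 0 \<epsilon> x = Untruncated" for x
    using assms by (simp add: symm_tester_def mean_sq_norm_def)
  then show ?thesis by (simp add: symm_tester_prob_def P.prob_space)
qed

text \<open>The space is a single point, so a set of positive volume is everything. In dimension 0
  no truncation can therefore be far from the Gaussian.\<close>

lemma gaussian_vol_dim_0:
  assumes K: "K \<in> sets (lebesgue_Rn 0)" and pos: "gaussian_vol 0 K > 0"
  shows "gaussian_vol 0 K = 1"
proof -
  interpret prob_space "std_gaussian 0" by (rule prob_space_std_gaussian)
  have "K \<noteq> {}" using pos by (auto simp: gaussian_vol_def)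
  moreover have sp: "space (std_gaussian 0) = {\<lambda>_. undefined}"
    by (simp add: std_gaussian_eq_completion space_gauss)
  moreover have "K \<subseteq> space (std_gaussian 0)"
    using sets.sets_into_space[OF K] by (simp add: std_gaussian_def)
  ultimately have "K = space (std_gaussian 0)" by auto
  then show ?thesis using prob_space by (simp add: gaussian_vol_def)
qed

theorem theorem3p4:
  shows "\<exists>c C :: real. c > 0 \<and> C > 0 \<and>
    (\<forall>(n::nat) (\<epsilon>::real). \<forall>D \<in> P_symm n. \<epsilon> > 0 \<longrightarrow>
       (D = std_gaussian n \<longrightarrow> symm_tester_prob c C n \<epsilon> D Untruncated \<ge> 9 / 10) \<and>
       (tv_dist D (std_gaussian n) \<ge> \<epsilon> \<longrightarrow> symm_tester_prob c C n \<epsilon> D Truncated \<ge> 9 / 10))"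
proof (rule exI[of _ "1 / 32"], rule exI[of _ "2 ^ 18"], intro conjI allI ballI impI)
  \<comment> \<open>c = 1/32 is the constant of the saving in
    \<open>nn_integral_exp_truncated_gaussian\<close>. C = 2^18 makes the smaller Chernoff exponent,
    \<epsilon>^2 / (2^16 n) per sample, add up to at least 4.\<close>
  fix n :: nat and \<epsilon> :: real and D
  assume \<epsilon>: "\<epsilon> > 0" and "D \<in> P_symm n"
  then obtain K where D: "D = truncated_gaussian n K" and K: "K \<in> sets (lebesgue_Rn n)"
    "gaussian_vol n K > 0" "symmetric_Rn n K" "convex_Rn n K"
    by (auto simp: P_symm_def)
  show "symm_tester_prob (1 / 32) (2 ^ 18) n \<epsilon> D Untruncated \<ge> 9 / 10" if "D = std_gaussian n"
  proof (cases "n = 0")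
    case True
    with \<epsilon> show ?thesis
      unfolding that by (simp add: symm_tester_prob_dim_0 prob_space_std_gaussian)
  next
    case False
    with \<epsilon> show ?thesis unfolding that by (intro untruncated_case) auto
  qed
  show "symm_tester_prob (1 / 32) (2 ^ 18) n \<epsilon> D Truncated \<ge> 9 / 10" if "tv_dist D (std_gaussian n) \<ge> \<epsilon>"
  proof -
    have le: "\<epsilon> \<le> 1 - gaussian_vol n K"
      using that tv_dist_truncated_gaussian_le[OF K(1,2)] by (simp add: D)
    have "n > 0"
      using \<epsilon> le K gaussian_vol_dim_0[of K] by (cases "n = 0") auto
    with K \<epsilon> le show ?thesis unfolding D by (intro truncated_case) auto
  qed
qed simp_all

end
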